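(* Let $u_s[N]$ ($s=1,2$) be the $N$-bright soliton solution (with different velocities) of the coupled Fokas–Lenells equation, as defined in the context. When $t\to\pm\infty$, the asymptotics of the $N$-soliton solution is $$u_s[N]=\sum_{k=1}^{N}u_{s,\pm}^{[k]}+O(\mathrm e^{-c|t|}),\qquad c=\min_{1\le i\le N}|z_{i,I}|\cdot\min_{i\ne j}|v_i-v_j|,$$ where $$u_{s,\pm}^{[k]}=\hat c_{k,s}^{\pm}\,\frac{z_k-z_k^*}{|z_k|^2}\,\frac{\mathrm e^{2\widehat\theta_{k,\pm}^{*}}}{\lambda_k\mathrm e^{2(\widehat\theta_{k,\pm}^*+\widehat\theta_{k,\pm})}+\lambda_k^*\delta_k^{\pm}},$$ $$\widehat\theta_{k,-}=\theta_k+\frac12\sum_{j=k+1}^N\ln\frac{z_j-z_k}{z_j^*-z_k},\quad \hat c_{k,s}^-=\frac{\det\widehat C_s(\Delta_k)}{\det C(\Delta_{k-1})}\prod_{j=k+1}^N\frac{z_j^2}{|z_j|^2},\quad \delta_k^-=\frac{z_k-z_k^*}{|z_k|^2}\frac{\det C(\Delta_k)}{\det C(\Delta_{k-1})},$$ $$\widehat\theta_{k,+}=\theta_k+\frac12\sum_{j=1}^{k-1}\ln\frac{z_j-z_k}{z_j^*-z_k},\quad \hat c_{k,s}^+=\frac{\det\widehat C_s(\Delta^k)}{\det C(\Delta^{k+1})}\prod_{j=1}^{k-1}\frac{z_j^2}{|z_j|^2},\quad \delta_k^+=\frac{z_k-z_k^*}{|z_k|^2}\frac{\det C(\Delta^k)}{\det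 C(\Delta^{k+1})}.$$
   Context: Coupled Fokas–Lenells equation ($\sigma=\pm1$): $u_{1,xt}+u_1+\mathrm i(|u_1|^2+\frac12\sigma|u_2|^2)u_{1,x}+\frac{\mathrm i}{2}\sigma u_1u_2^*u_{2,x}=0$, $u_{2,xt}+u_2+\mathrm i(\sigma|u_2|^2+\frac12|u_1|^2)u_{2,x}+\frac{\mathrm i}{2}u_2u_1^*u_{1,x}=0$. $N$-bright soliton: $\lambda_i\in\mathbb C\setminus(\mathbb R\cup\mathrm i\mathbb R)$, $z_i=\lambda_i^{-2}=z_{i,R}+\mathrm iz_{i,I}$ with $z_{i,I}<0$, $c_{i,1},c_{i,2}\in\mathbb C$, $\theta_i=\mathrm i(z_ix+\frac1{4z_i}t)=-z_{i,I}(x-v_it)+\mathrm iz_{i,R}(x+v_it)$, $v_i=\frac1{4|z_i|^2}$; the solitons are labelled so that $v_1<v_2<\cdots<v_N$. With $\gamma_{i,j}=-(c_{i,1}^*c_{j,1}+\sigma c_{i,2}^*c_{j,2})$, $m_{i,j}=\frac{2z_i^*z_j}{z_j-z_i^*}[\lambda_j\mathrm e^{\theta_i^*+\theta_j}+\lambda_i^*\gamma_{i,j}\mathrm e^{-\theta_i^*-\theta_j}]$, $M=(m_{i,j})_{1\le i,j\le N}$, $Y_1=(\mathrm e^{\theta_1},\dots,\mathrm e^{\theta_N})$, $Y_2^{[s]}=(c_{1,s}\mathrm e^{-\theta_1},\dots,c_{N,s}\mathrm e^{-\theta_N})$, $$u_s[N]=-2\det\begin{pmatrix} M & Y_1^\dagger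 \\ Y_2^{[s]} & 0 \end{pmatrix}\Big/\det M .$$ Generalized Cauchy matrices: $\Lambda=\mathrm{diag}(-1,-\sigma)$, $c_i=z_i(c_{i,1},c_{i,2})^{\mathrm T}$, $C(\Delta_k)=\Big[\frac{c_i^\dagger\Lambda c_j}{z_j-z_i^*}\Big]_{1\le i,j\le k}$, $C(\Delta^k)=\Big[\frac{c_i^\dagger\Lambda c_j}{z_j-z_i^*}\Big]_{k\le i,j\le N}$ (empty determinants equal $1$). $\widehat C_s(\Delta_k)$ is the $k\times k$ matrix whose first $k-1$ rows are $\Big[\frac{c_i^\dagger\Lambda c_j}{z_j-z_i^*}\Big]_{1\le i\le k-1,\,1\le j\le k}$ and whose last row is $(c_{1,s},\dots,c_{k,s})$. $\widehat C_s(\Delta^k)$ is the $(N-k+1)\times(N-k+1)$ matrix whose first row is $(c_{k,s},\dots,c_{N,s})$ and whose remaining rows are $\Big[\frac{c_i^\dagger\Lambda c_j}{z_j-z_i^*}\Big]_{k+1\le i\le N,\,k\le j\le N}$. $^*$ is complex conjugation and $^\dagger$ conjugate transpose.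
   Formalization: Added: each (c_{i,1},c_{i,2}) is nonzero and, for σ=−1, all det C(Δ_k) (t→−∞), resp. det C(Δ^k) (t→+∞), k=1..N, are nonzero; otherwise the formulas divide by zero or the solution is unbounded in x. The O-term is uniform in x. *)

theory Defs
  imports
    "HOL-Analysis.Complex_Transcendental"
    "Jordan_Normal_Form.Determinant"
begin

text \<open>
  Solitons are numbered \<open>1, \<dots>, N\<close> and components \<open>s \<in> {1, 2}\<close>; the norming constant
  \<open>c\<^bsub>i,s\<^esub>\<close> is \<open>c i s\<close>.  Matrix indices of type \<open>mat\<close> start at \<open>0\<close>, hence the shifts below.
\<close>

definition zpar :: "(nat \<Rightarrow> complex) \<Rightarrow> nat \<Rightarrow> complex" where
  "zpar lam i = 1 / (lam i)\<^sup>2"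

definition vel :: "(nat \<Rightarrow> complex) \<Rightarrow> nat \<Rightarrow> real" where
  "vel lam i = 1 / (4 * (cmod (zpar lam i))\<^sup>2)"

definition theta :: "(nat \<Rightarrow> complex) \<Rightarrow> nat \<Rightarrow> real \<Rightarrow> real \<Rightarrow> complex" where
  "theta lam i x t = \<i> * (zpar lam i * of_real x + 1 / (4 * zpar lam i) * of_real t)"

definition gam :: "real \<Rightarrow> (nat \<Rightarrow> nat \<Rightarrow> complex) \<Rightarrow> nat \<Rightarrow> nat \<Rightarrow> complex" where
  "gam \<sigma> c i j = - (cnj (c i 1) * c j 1 + of_real \<sigma> * cnj (c i 2) * c j 2)"

definition M_entry ::
    "real \<Rightarrow> (nat \<Rightarrow> complex) \<Rightarrow> (nat \<Rightarrow> nat \<Rightarrow> complex) \<Rightarrow> real \<Rightarrow> real \<Rightarrow> nat \<Rightarrow> nat \<Rightarrow> complex" where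
  "M_entry \<sigma> lam c x t i j =
     2 * cnj (zpar lam i) * zpar lam j / (zpar lam j - cnj (zpar lam i)) *
     (lam j * exp (cnj (theta lam i x t) + theta lam j x t)
      + cnj (lam i) * gam \<sigma> c i j * exp (- cnj (theta lam i x t) - theta lam j x t))"

definition M_mat ::
    "real \<Rightarrow> nat \<Rightarrow> (nat \<Rightarrow> complex) \<Rightarrow> (nat \<Rightarrow> nat \<Rightarrow> complex) \<Rightarrow> real \<Rightarrow> real \<Rightarrow> complex mat" where
  "M_mat \<sigma> N lam c x t = mat N N (\<lambda>(i, j). M_entry \<sigma> lam c x t (i + 1) (j + 1))"

definition Y1_dagger :: "nat \<Rightarrow> (nat \<Rightarrow> complex) \<Rightarrow> real \<Rightarrow> real \<Rightarrow> complex mat" where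
  "Y1_dagger N lam x t = mat N 1 (\<lambda>(i, _). cnj (exp (theta lam (i + 1) x t)))"

definition Y2_row ::
    "nat \<Rightarrow> (nat \<Rightarrow> complex) \<Rightarrow> (nat \<Rightarrow> nat \<Rightarrow> complex) \<Rightarrow> nat \<Rightarrow> real \<Rightarrow> real \<Rightarrow> complex mat" where
  "Y2_row N lam c s x t = mat 1 N (\<lambda>(_, j). c (j + 1) s * exp (- theta lam (j + 1) x t))"

definition u_soliton ::
    "real \<Rightarrow> nat \<Rightarrow> (nat \<Rightarrow> complex) \<Rightarrow> (nat \<Rightarrow> nat \<Rightarrow> complex) \<Rightarrow> nat \<Rightarrow> real \<Rightarrow> real \<Rightarrow> complex" where
  "u_soliton \<sigma> N lam c s x t =
     - 2 * det (four_block_mat (M_mat \<sigma> N lam c x t) (Y1_dagger N lam x t)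
                               (Y2_row N lam c s x t) (0\<^sub>m 1 1))
     / det (M_mat \<sigma> N lam c x t)"

definition Lambda_diag :: "real \<Rightarrow> nat \<Rightarrow> complex" where
  "Lambda_diag \<sigma> s = (if s = 1 then - 1 else - of_real \<sigma>)"

definition cvec :: "(nat \<Rightarrow> complex) \<Rightarrow> (nat \<Rightarrow> nat \<Rightarrow> complex) \<Rightarrow> nat \<Rightarrow> nat \<Rightarrow> complex" where
  "cvec lam c i s = zpar lam i * c i s"

definition cauchy_entry ::
    "real \<Rightarrow> (nat \<Rightarrow> complex) \<Rightarrow> (nat \<Rightarrow> nat \<Rightarrow> complex) \<Rightarrow> nat \<Rightarrow> nat \<Rightarrow> complex" where
  "cauchy_entry \<sigma> lam c i j =
     (\<Sum>s\<in>{1, 2}. cnj (cvec lam c i s) * Lambda_diag \<sigma> s * cvec lam c j s)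
     / (zpar lam j - cnj (zpar lam i))"

text \<open>
  The suffix \<open>low\<close> belongs to the index range \<open>1, \<dots>, k\<close> (lower index on \<open>\<Delta>\<close>), the suffix
  \<open>up\<close> to \<open>k, \<dots>, N\<close> (upper index).  \<open>C_low 0\<close> and \<open>C_up (N + 1)\<close> are empty, with determinant 1.
  For \<open>\<sigma> = 1\<close> and nonzero vectors \<open>(c i 1, c i 2)\<close> all determinants of \<open>C_low\<close> and \<open>C_up\<close> are
  nonzero; for \<open>\<sigma> = - 1\<close> they may vanish, and then the asymptotic formulas are either
  undefined or, if it is the full \<open>N \<times> N\<close> determinant, belong to an unbounded solution.
\<close>

definition C_low ::
    "real \<Rightarrow> (nat \<Rightarrow> complex) \<Rightarrow> (nat \<Rightarrow> nat \<Rightarrow> complex) \<Rightarrow> nat \<Rightarrow> complex mat" where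
  "C_low \<sigma> lam c k = mat k k (\<lambda>(i, j). cauchy_entry \<sigma> lam c (i + 1) (j + 1))"

definition C_up ::
    "real \<Rightarrow> nat \<Rightarrow> (nat \<Rightarrow> complex) \<Rightarrow> (nat \<Rightarrow> nat \<Rightarrow> complex) \<Rightarrow> nat \<Rightarrow> complex mat" where
  "C_up \<sigma> N lam c k =
     mat (N + 1 - k) (N + 1 - k) (\<lambda>(i, j). cauchy_entry \<sigma> lam c (k + i) (k + j))"

definition Chat_low ::
    "real \<Rightarrow> (nat \<Rightarrow> complex) \<Rightarrow> (nat \<Rightarrow> nat \<Rightarrow> complex) \<Rightarrow> nat \<Rightarrow> nat \<Rightarrow> complex mat" where
  "Chat_low \<sigma> lam c s k =
     mat k k (\<lambda>(i, j). if i + 1 < k then cauchy_entry \<sigma> lam c (i + 1) (j + 1) else c (j + 1) s)"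

definition Chat_up ::
    "real \<Rightarrow> nat \<Rightarrow> (nat \<Rightarrow> complex) \<Rightarrow> (nat \<Rightarrow> nat \<Rightarrow> complex) \<Rightarrow> nat \<Rightarrow> nat \<Rightarrow> complex mat" where
  "Chat_up \<sigma> N lam c s k =
     mat (N + 1 - k) (N + 1 - k)
       (\<lambda>(i, j). if i = 0 then c (k + j) s else cauchy_entry \<sigma> lam c (k + i) (k + j))"

text \<open>
  In the shifts below \<open>ln\<close> is the principal branch, but only \<open>exp (2 * \<theta>)\<close> and its
  conjugate are used, so the branch is immaterial.
\<close>

definition theta_minus :: "nat \<Rightarrow> (nat \<Rightarrow> complex) \<Rightarrow> nat \<Rightarrow> real \<Rightarrow> real \<Rightarrow> complex" where
  "theta_minus N lam k x t = theta lam k x t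
     + 1 / 2 * (\<Sum>j=k+1..N. ln ((zpar lam j - zpar lam k) / (cnj (zpar lam j) - zpar lam k)))"

definition theta_plus :: "(nat \<Rightarrow> complex) \<Rightarrow> nat \<Rightarrow> real \<Rightarrow> real \<Rightarrow> complex" where
  "theta_plus lam k x t = theta lam k x t
     + 1 / 2 * (\<Sum>j=1..<k. ln ((zpar lam j - zpar lam k) / (cnj (zpar lam j) - zpar lam k)))"

definition chat_minus ::
    "real \<Rightarrow> nat \<Rightarrow> (nat \<Rightarrow> complex) \<Rightarrow> (nat \<Rightarrow> nat \<Rightarrow> complex) \<Rightarrow> nat \<Rightarrow> nat \<Rightarrow> complex" where
  "chat_minus \<sigma> N lam c s k =
     det (Chat_low \<sigma> lam c s k) / det (C_low \<sigma> lam c (k - 1))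
     * (\<Prod>j=k+1..N. (zpar lam j)\<^sup>2 / of_real ((cmod (zpar lam j))\<^sup>2))"

definition chat_plus ::
    "real \<Rightarrow> nat \<Rightarrow> (nat \<Rightarrow> complex) \<Rightarrow> (nat \<Rightarrow> nat \<Rightarrow> complex) \<Rightarrow> nat \<Rightarrow> nat \<Rightarrow> complex" where
  "chat_plus \<sigma> N lam c s k =
     det (Chat_up \<sigma> N lam c s k) / det (C_up \<sigma> N lam c (k + 1))
     * (\<Prod>j=1..<k. (zpar lam j)\<^sup>2 / of_real ((cmod (zpar lam j))\<^sup>2))"

definition zratio :: "(nat \<Rightarrow> complex) \<Rightarrow> nat \<Rightarrow> complex" where
  "zratio lam k = (zpar lam k - cnj (zpar lam k)) / of_real ((cmod (zpar lam k))\<^sup>2)"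

definition delta_minus ::
    "real \<Rightarrow> (nat \<Rightarrow> complex) \<Rightarrow> (nat \<Rightarrow> nat \<Rightarrow> complex) \<Rightarrow> nat \<Rightarrow> complex" where
  "delta_minus \<sigma> lam c k =
     zratio lam k * (det (C_low \<sigma> lam c k) / det (C_low \<sigma> lam c (k - 1)))"

definition delta_plus ::
    "real \<Rightarrow> nat \<Rightarrow> (nat \<Rightarrow> complex) \<Rightarrow> (nat \<Rightarrow> nat \<Rightarrow> complex) \<Rightarrow> nat \<Rightarrow> complex" where
  "delta_plus \<sigma> N lam c k =
     zratio lam k * (det (C_up \<sigma> N lam c k) / det (C_up \<sigma> N lam c (k + 1)))"

definition u_minus ::
    "real \<Rightarrow> nat \<Rightarrow> (nat \<Rightarrow> complex) \<Rightarrow> (nat \<Rightarrow> nat \<Rightarrow> complex) \<Rightarrow> nat \<Rightarrow> nat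
     \<Rightarrow> real \<Rightarrow> real \<Rightarrow> complex" where
  "u_minus \<sigma> N lam c s k x t =
     chat_minus \<sigma> N lam c s k * zratio lam k
     * (exp (2 * cnj (theta_minus N lam k x t))
        / (lam k * exp (2 * (cnj (theta_minus N lam k x t) + theta_minus N lam k x t))
           + cnj (lam k) * delta_minus \<sigma> lam c k))"

definition u_plus ::
    "real \<Rightarrow> nat \<Rightarrow> (nat \<Rightarrow> complex) \<Rightarrow> (nat \<Rightarrow> nat \<Rightarrow> complex) \<Rightarrow> nat \<Rightarrow> nat
     \<Rightarrow> real \<Rightarrow> real \<Rightarrow> complex" where
  "u_plus \<sigma> N lam c s k x t =
     chat_plus \<sigma> N lam c s k * zratio lam k
     * (exp (2 * cnj (theta_plus lam k x t))
        / (lam k * exp (2 * (cnj (theta_plus lam k x t) + theta_plus lam k x t))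
           + cnj (lam k) * delta_plus \<sigma> N lam c k))"

text \<open>
  For \<open>N = 1\<close> the second minimum is over the empty set and the value is unspecified; this is
  harmless, as the one-soliton solution equals its asymptotic form exactly.
\<close>

definition decay_rate :: "nat \<Rightarrow> (nat \<Rightarrow> complex) \<Rightarrow> real" where
  "decay_rate N lam =
     Min {\<bar>Im (zpar lam i)\<bar> | i. i \<in> {1..N}}
     * Min {\<bar>vel lam i - vel lam j\<bar> | i j. i \<in> {1..N} \<and> j \<in> {1..N} \<and> i \<noteq> j}"

end

theory Submission
  imports Defs
begin

text \<open>
  Up to scaling rows and columns, the matrix \<open>M\<close> has entries
  \<open>E\<^sub>i\<^sub>j p\<^sub>i\<^sup>* p\<^sub>j + F\<^sub>i\<^sub>j q\<^sub>i\<^sup>* q\<^sub>j\<close> with \<open>(p\<^sub>j, q\<^sub>j)\<close> proportional to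
  \<open>(e\<^bsup>\<theta>\<^esup>, e\<^bsup>-\<theta>\<^esup>)\<close> for \<open>\<theta> = \<theta>\<^sub>j\<close>, and \<open>u\<^sub>s[N]\<close> does not depend on the scaling.  Given
  \<open>(x, t)\<close> with \<open>t < 0\<close>, let \<open>k\<close> be the soliton nearest to \<open>x\<close> and scale so that \<open>p\<^sub>j = 1\<close>
  for \<open>j > k\<close>, \<open>q\<^sub>j = 1\<close> for \<open>j < k\<close>, and \<open>max |p\<^sub>k| |q\<^sub>k| = 1\<close>.  The other component of
  each \<open>j \<noteq> k\<close> has modulus \<open>e\<^bsup>-2|Re \<theta>|\<^esup>\<close>, which is at most \<open>e\<^bsup>-c|t|\<^esup>\<close> because \<open>x\<close> is at distance
  at least \<open>|v\<^sub>j - v\<^sub>k| |t| / 2\<close> from soliton \<open>j\<close>.  Setting these components to zero makes both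
  determinants block triangular; Cauchy's determinant then turns the quotient into the
  \<open>k\<close>-th one-soliton profile, while the remaining profiles are \<open>O(e\<^bsup>-c|t|\<^esup>)\<close> at \<open>x\<close>.
  Determinants are Lipschitz on bounded sets, and the limit denominator
  \<open>\<lambda>\<^sub>k |p\<^sub>k|\<^sup>2 a + \<lambda>\<^sub>k\<^sup>* \<delta>\<^sub>k |q\<^sub>k|\<^sup>2\<close> (with \<open>a > 0\<close>) is bounded away from zero because \<open>\<delta>\<^sub>k\<close> is
  real and \<open>\<lambda>\<^sub>k\<close> is neither real nor imaginary.  The case \<open>t > 0\<close> follows by reversing the
  order of the solitons.
\<close>

section \<open>Determinants of functions of two indices\<close>

text \<open>Taking the determinant of an index function avoids matrix carriers: leading blocks,
  index shifts and changes of single rows become operations on plain functions.\<close>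

definition fdet :: "nat \<Rightarrow> (nat \<Rightarrow> nat \<Rightarrow> 'a :: comm_ring_1) \<Rightarrow> 'a" where
  "fdet n f = det (mat n n (\<lambda>(i, j). f i j))"

lemma fdet_leibniz:
  "fdet n f = (\<Sum>p | p permutes {0..<n}. signof p * (\<Prod>i = 0..<n. f i (p i)))"
proof -
  have "fdet n f = (\<Sum>p | p permutes {0..<n}.
      signof p * (\<Prod>i = 0..<n. mat n n (\<lambda>(i, j). f i j) $$ (i, p i)))"
    unfolding fdet_def by (rule det_def'[where n = n]) simp
  also have "\<dots> = (\<Sum>p | p permutes {0..<n}. signof p * (\<Prod>i = 0..<n. f i (p i)))"
  proof (rule sum.cong[OF refl])
    fix p assume "p \<in> {p. p permutes {0..<n}}"
    then have "\<And>i. i < n \<Longrightarrow> p i < n" by (auto dest: permutes_in_image)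
    then show "signof p * (\<Prod>i = 0..<n. mat n n (\<lambda>(i, j). f i j) $$ (i, p i))
        = signof p * (\<Prod>i = 0..<n. f i (p i))" by simp
  qed
  finally show ?thesis .
qed

lemma fdet_cong:
  assumes "m = n" and "\<And>i j. i < n \<Longrightarrow> j < n \<Longrightarrow> f i j = g i j"
  shows "fdet m f = fdet n g"
proof -
  have "mat m m (\<lambda>(i, j). f i j) = mat n n (\<lambda>(i, j). g i j)"
    by (rule eq_matI) (use assms in auto)
  then show ?thesis by (simp add: fdet_def)
qed

lemma fdet_0 [simp]: "fdet 0 f = 1"
  by (simp add: fdet_def)

lemma fdet_scale:
  "fdet n (\<lambda>i j. a i * b j * f i j) = (\<Prod>i<n. a i) * (\<Prod>j<n. b j) * fdet n f"
proof -
  have "signof p * (\<Prod>i = 0..<n. a i * b (p i) * f i (p i))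
      = (\<Prod>i<n. a i) * (\<Prod>j<n. b j) * (signof p * (\<Prod>i = 0..<n. f i (p i)))"
    if "p permutes {0..<n}" for p
  proof -
    have "(\<Prod>i = 0..<n. b (p i)) = (\<Prod>j<n. b j)"
      using prod.permute[OF that, of b] by (simp add: atLeast0LessThan)
    then show ?thesis by (simp add: prod.distrib atLeast0LessThan mult_ac)
  qed
  then show ?thesis unfolding fdet_leibniz sum_distrib_left by (intro sum.cong) auto
qed

lemma fdet_transpose: "fdet n (\<lambda>i j. f j i) = fdet n f"
proof -
  have "transpose_mat (mat n n (\<lambda>(i, j). f i j)) = mat n n (\<lambda>(i, j). f j i)"
    by (rule eq_matI) auto
  then show ?thesis unfolding fdet_def
    by (metis (no_types, lifting) det_transpose mat_carrier)
qed

lemma fdet_permute_rows: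
  assumes "p permutes {0..<n}"
  shows "fdet n (\<lambda>i j. f (p i) j) = signof p * fdet n f"
proof -
  have "mat n n (\<lambda>(i, j). f (p i) j)
      = mat n n (\<lambda>(i, j). mat n n (\<lambda>(i, j). f i j) $$ (p i, j))"
    using permutes_in_image[OF assms] by (intro eq_matI) auto
  then show ?thesis unfolding fdet_def
    using det_permute_rows[OF _ assms, of "mat n n (\<lambda>(i, j). f i j)"] by simp
qed

lemma fdet_permute:
  assumes "p permutes {0..<n}" "q permutes {0..<n}"
  shows "fdet n (\<lambda>i j. f (p i) (q j)) = signof p * signof q * fdet n f"
proof -
  have "fdet n (\<lambda>i j. f (p i) (q j)) = signof p * fdet n (\<lambda>i j. f i (q j))"
    by (rule fdet_permute_rows[OF assms(1)])
  also have "fdet n (\<lambda>i j. f i (q j)) = fdet n (\<lambda>i j. f j (q i))"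
    by (subst fdet_transpose[symmetric]) simp
  also have "\<dots> = signof q * fdet n (\<lambda>i j. f j i)"
    by (rule fdet_permute_rows[OF assms(2)])
  also have "fdet n (\<lambda>i j. f j i) = fdet n f" by (rule fdet_transpose)
  finally show ?thesis by (simp add: mult.assoc)
qed

text \<open>Rows and columns contribute the same sign, whose square is 1. This makes renumbering the
  solitons harmless.\<close>

lemma fdet_permute_same:
  assumes "p permutes {0..<n}"
  shows "fdet n (\<lambda>i j. f (p i) (p j)) = fdet n f"
proof -
  have "(signof p :: 'a) * signof p = 1"
    using signof_pm_one[of p, where ?'a = 'a] by auto
  then show ?thesis by (simp add: fdet_permute[OF assms assms])
qed

lemma fdet_rev: "fdet n (\<lambda>i j. f (n - 1 - i) (n - 1 - j)) = fdet n f"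
proof -
  define p where "p = (\<lambda>i. if i < n then n - 1 - i else i)"
  have "bij_betw p {0..<n} {0..<n}"
    by (rule bij_betwI[where g = p]) (auto simp: p_def)
  then have p: "p permutes {0..<n}"
    by (rule bij_imp_permutes) (simp add: p_def)
  have "fdet n (\<lambda>i j. f (n - 1 - i) (n - 1 - j)) = fdet n (\<lambda>i j. f (p i) (p j))"
    by (rule fdet_cong) (auto simp: p_def)
  also have "\<dots> = fdet n f" by (rule fdet_permute_same[OF p])
  finally show ?thesis .
qed

text \<open>Every Leibniz product has exactly one factor from row \<open>m\<close>. The lemma serves
  to separate the growing from the decaying part of the row of soliton \<open>k\<close>.\<close>

lemma fdet_row_add:
  assumes "m < n"
  shows "fdet n (\<lambda>i j. if i = m then a j + b j else f i j)
    = fdet n (\<lambda>i j. if i = m then a j else f i j) + fdet n (\<lambda>i j. if i = m then b j else f i j)"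
proof -
  have split: "(\<Prod>i = 0..<n. if i = m then r (p i) else f i (p i))
      = r (p m) * (\<Prod>i \<in> {0..<n} - {m}. f i (p i))" for r :: "nat \<Rightarrow> 'a" and p
    using assms by (subst prod.remove[of _ m]) (auto intro!: prod.cong)
  show ?thesis unfolding fdet_leibniz sum.distrib[symmetric]
    by (rule sum.cong)
      (simp_all only: split[of "\<lambda>j. a j + b j"] split[of a] split[of b] algebra_simps)
qed

lemma fdet_block_upper_right_zero:
  fixes f :: "nat \<Rightarrow> nat \<Rightarrow> 'a :: idom"
  assumes "\<And>i j. i < m \<Longrightarrow> j < n \<Longrightarrow> f i (m + j) = 0"
  shows "fdet (m + n) f = fdet m f * fdet n (\<lambda>i j. f (m + i) (m + j))"
proof -
  have "mat (m + n) (m + n) (\<lambda>(i, j). f i j) =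
      four_block_mat (mat m m (\<lambda>(i, j). f i j)) (0\<^sub>m m n)
        (mat n m (\<lambda>(i, j). f (m + i) j)) (mat n n (\<lambda>(i, j). f (m + i) (m + j)))"
  proof (rule eq_matI)
    fix i j
    assume "i < dim_row (four_block_mat (mat m m (\<lambda>(i, j). f i j)) (0\<^sub>m m n)
        (mat n m (\<lambda>(i, j). f (m + i) j)) (mat n n (\<lambda>(i, j). f (m + i) (m + j))))"
      "j < dim_col (four_block_mat (mat m m (\<lambda>(i, j). f i j)) (0\<^sub>m m n)
        (mat n m (\<lambda>(i, j). f (m + i) j)) (mat n n (\<lambda>(i, j). f (m + i) (m + j))))"
    then show "mat (m + n) (m + n) (\<lambda>(i, j). f i j) $$ (i, j) =
        four_block_mat (mat m m (\<lambda>(i, j). f i j)) (0\<^sub>m m n)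
        (mat n m (\<lambda>(i, j). f (m + i) j)) (mat n n (\<lambda>(i, j). f (m + i) (m + j))) $$ (i, j)"
      using assms[of i "j - m"] by (cases "i < m"; cases "j < m") simp_all
  qed simp_all
  then show ?thesis unfolding fdet_def
    by (simp add: det_four_block_mat_upper_right_zero[where n = m and m = n])
qed

lemma fdet_block_lower_left_zero:
  fixes f :: "nat \<Rightarrow> nat \<Rightarrow> 'a :: idom"
  assumes "\<And>i j. i < n \<Longrightarrow> j < m \<Longrightarrow> f (m + i) j = 0"
  shows "fdet (m + n) f = fdet m f * fdet n (\<lambda>i j. f (m + i) (m + j))"
proof -
  have "fdet (m + n) f = fdet (m + n) (\<lambda>i j. f j i)" by (rule fdet_transpose[symmetric])
  also have "\<dots> = fdet m (\<lambda>i j. f j i) * fdet n (\<lambda>i j. f (m + j) (m + i))"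
    by (rule fdet_block_upper_right_zero) (use assms in simp)
  also have "\<dots> = fdet m f * fdet n (\<lambda>i j. f (m + i) (m + j))"
    using fdet_transpose[of m f] fdet_transpose[of n "\<lambda>i j. f (m + i) (m + j)"] by simp
  finally show ?thesis .
qed

text \<open>One step of Gaussian elimination, written as a factorization: a unit lower triangular
  matrix that differs from the identity only in column 0, times a matrix whose column 0 vanishes
  below the pivot. Both Cauchy-type evaluations below rest on it.\<close>

lemma fdet_schur:
  fixes f :: "nat \<Rightarrow> nat \<Rightarrow> 'a :: field"
  assumes "f 0 0 \<noteq> 0"
  shows "fdet (Suc n) f
    = f 0 0 * fdet n (\<lambda>i j. f (Suc i) (Suc j) - f (Suc i) 0 * f 0 (Suc j) / f 0 0)"
proof -
  let ?L = "mat (Suc n) (Suc n)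
    (\<lambda>(i, j). if i = j then 1 else if j = 0 then f i 0 / f 0 0 else 0)"
  let ?g = "\<lambda>i j. if i = 0 then f 0 j else f i j - f i 0 * f 0 j / f 0 0"
  let ?G = "mat (Suc n) (Suc n) (\<lambda>(i, j). ?g i j)"
  have prod: "mat (Suc n) (Suc n) (\<lambda>(i, j). f i j) = ?L * ?G"
  proof (rule eq_matI)
    fix i j assume "i < dim_row (?L * ?G)" "j < dim_col (?L * ?G)"
    then have ij: "i < Suc n" "j < Suc n" by auto
    have "(?L * ?G) $$ (i, j)
        = (\<Sum>l = 0..<Suc n. (if i = l then 1 else if l = 0 then f i 0 / f 0 0 else 0) * ?g l j)"
      using ij by (simp add: scalar_prod_def del: sum.op_ivl_Suc)
    also have "\<dots> = (\<Sum>l \<in> {0, i}. (if i = l then 1 else if l = 0 then f i 0 / f 0 0 else 0) * ?g l j)"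
      by (rule sum.mono_neutral_right) (use ij in auto)
    also have "\<dots> = f i j" using assms by (cases "i = 0") auto
    finally show "mat (Suc n) (Suc n) (\<lambda>(i, j). f i j) $$ (i, j) = (?L * ?G) $$ (i, j)"
      using ij by simp
  qed auto
  have "det ?L = prod_list (diag_mat ?L)"
    by (rule det_lower_triangular[where n = "Suc n"]) auto
  also have "diag_mat ?L = map (\<lambda>_. 1) [0..<Suc n]"
    unfolding diag_mat_def by (rule map_cong) auto
  also have "prod_list \<dots> = (1 :: 'a)" by (simp add: map_replicate_const)
  finally have L: "det ?L = 1" .
  have "fdet (Suc n) f = det ?L * det ?G"
    unfolding fdet_def prod by (rule det_mult[where n = "Suc n"]) auto
  also have "\<dots> = fdet (1 + n) ?g" unfolding L by (simp add: fdet_def)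
  also have "\<dots> = fdet 1 ?g * fdet n (\<lambda>i j. ?g (1 + i) (1 + j))"
    by (rule fdet_block_lower_left_zero) (use assms in auto)
  also have "fdet 1 ?g = f 0 0" unfolding fdet_def by (subst det_single) auto
  finally show ?thesis by simp
qed

lemma fdet_cnj: "cnj (fdet n f) = fdet n (\<lambda>i j. cnj (f i j))"
proof -
  have "cnj (signof p) = signof p" for p
    using signof_pm_one[of p, where ?'a = complex] by auto
  then show ?thesis unfolding fdet_leibniz by simp
qed

text \<open>Each of the \<open>fact n\<close> Leibniz products is compared by telescoping. The
  estimate \<open>norm_prod_diff\<close> asks for factors of norm at most 1, hence the division of
  all entries by \<open>B\<close>. What matters later is that the bound is linear in
  \<open>e\<close>.\<close>

lemma norm_fdet_diff_le:
  fixes f g :: "nat \<Rightarrow> nat \<Rightarrow> complex"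
  assumes "B > 0"
    and "\<And>i j. i < n \<Longrightarrow> j < n \<Longrightarrow> norm (f i j) \<le> B"
    and "\<And>i j. i < n \<Longrightarrow> j < n \<Longrightarrow> norm (g i j) \<le> B"
    and "\<And>i j. i < n \<Longrightarrow> j < n \<Longrightarrow> norm (f i j - g i j) \<le> e"
  shows "norm (fdet n f - fdet n g) \<le> fact n * B ^ n * real n / B * e"
proof -
  have "norm (fdet n f - fdet n g)
      \<le> (\<Sum>p | p permutes {0..<n}. B ^ n * real n / B * e)"
    unfolding fdet_leibniz sum_subtractf[symmetric]
  proof (rule sum_norm_le)
    fix p assume "p \<in> {p. p permutes {0..<n}}"
    then have p: "\<And>i. i < n \<Longrightarrow> p i < n" by (auto dest: permutes_in_image)
    have 1: "norm (signof p :: complex) = 1"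
      by (simp add: sign_def)
    have scale: "(\<Prod>i = 0..<n. h i) = B ^ n * (\<Prod>i = 0..<n. h i / of_real B)" for h :: "nat \<Rightarrow> complex"
      using assms(1) by (simp add: prod_dividef)
    have "norm (signof p * (\<Prod>i = 0..<n. f i (p i)) - signof p * (\<Prod>i = 0..<n. g i (p i)))
        = norm ((\<Prod>i = 0..<n. f i (p i)) - (\<Prod>i = 0..<n. g i (p i)))"
      unfolding right_diff_distrib[symmetric] norm_mult 1 by simp
    also have "\<dots> = B ^ n * norm ((\<Prod>i = 0..<n. f i (p i) / of_real B) - (\<Prod>i = 0..<n. g i (p i) / of_real B))"
      unfolding scale[of "\<lambda>i. f i (p i)"] scale[of "\<lambda>i. g i (p i)"] right_diff_distrib[symmetric] norm_mult
      using assms(1) by (simp add: norm_power)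
    also have "\<dots> \<le> B ^ n * (\<Sum>i = 0..<n. norm (f i (p i) / of_real B - g i (p i) / of_real B))"
      by (intro mult_left_mono norm_prod_diff) (use assms(1-3) p in \<open>auto simp: norm_divide\<close>)
    also have "\<dots> \<le> B ^ n * (\<Sum>i = 0..<n. e / B)"
      using assms(1,4) p
      by (intro mult_left_mono sum_mono)
        (auto simp: norm_divide diff_divide_distrib[symmetric] divide_right_mono)
    finally show "norm (signof p * (\<Prod>i = 0..<n. f i (p i)) - signof p * (\<Prod>i = 0..<n. g i (p i)))
        \<le> B ^ n * real n / B * e" by simp
  qed
  also have "\<dots> = fact n * B ^ n * real n / B * e"
    using card_permutations[of "{0..<n}" n] by simp
  finally show ?thesis .
qed

section \<open>The soliton as a quotient of homogeneous determinants\<close>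

text \<open>Coefficient of \<open>exp (cnj (theta i) + theta j)\<close> in the entry of
  \<open>M\<close>; \<open>decay_coef\<close> is the coefficient of the reciprocal
  exponential.\<close>

definition grow_coef :: "(nat \<Rightarrow> complex) \<Rightarrow> nat \<Rightarrow> nat \<Rightarrow> complex" where
  "grow_coef lam i j = 2 * cnj (zpar lam i) * zpar lam j * lam j / (zpar lam j - cnj (zpar lam i))"

definition decay_coef ::
    "real \<Rightarrow> (nat \<Rightarrow> complex) \<Rightarrow> (nat \<Rightarrow> nat \<Rightarrow> complex) \<Rightarrow> nat \<Rightarrow> nat \<Rightarrow> complex" where
  "decay_coef \<sigma> lam c i j = 2 * cnj (lam i) * cauchy_entry \<sigma> lam c i j"

text \<open>With arbitrary \<open>p\<close>, \<open>q\<close> in place of the exponentials, the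
  entries are homogeneous in each pair \<open>(p j, q j)\<close>. Solitons can then be rescaled one
  by one, and the value 0, which an exponential only approaches, can be inserted.\<close>

definition pq_entry ::
    "real \<Rightarrow> (nat \<Rightarrow> complex) \<Rightarrow> (nat \<Rightarrow> nat \<Rightarrow> complex) \<Rightarrow> (nat \<Rightarrow> complex) \<Rightarrow> (nat \<Rightarrow> complex)
     \<Rightarrow> nat \<Rightarrow> nat \<Rightarrow> complex" where
  "pq_entry \<sigma> lam c p q i j
     = grow_coef lam i j * (cnj (p i) * p j) + decay_coef \<sigma> lam c i j * (cnj (q i) * q j)"

text \<open>Index \<open>N\<close> is the border; an index \<open>i < N\<close> stands for soliton
  \<open>Suc i\<close>.\<close>

definition pq_bordered ::
    "real \<Rightarrow> nat \<Rightarrow> (nat \<Rightarrow> complex) \<Rightarrow> (nat \<Rightarrow> nat \<Rightarrow> complex) \<Rightarrow> nat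
     \<Rightarrow> (nat \<Rightarrow> complex) \<Rightarrow> (nat \<Rightarrow> complex) \<Rightarrow> nat \<Rightarrow> nat \<Rightarrow> complex" where
  "pq_bordered \<sigma> N lam c s p q i j =
     (if i < N then if j < N then pq_entry \<sigma> lam c p q (Suc i) (Suc j) else cnj (p (Suc i))
      else if j < N then c (Suc j) s * q (Suc j) else 0)"

definition soliton_den ::
    "real \<Rightarrow> nat \<Rightarrow> (nat \<Rightarrow> complex) \<Rightarrow> (nat \<Rightarrow> nat \<Rightarrow> complex)
     \<Rightarrow> (nat \<Rightarrow> complex) \<Rightarrow> (nat \<Rightarrow> complex) \<Rightarrow> complex" where
  "soliton_den \<sigma> N lam c p q = fdet N (\<lambda>i j. pq_entry \<sigma> lam c p q (Suc i) (Suc j))"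

definition soliton_num ::
    "real \<Rightarrow> nat \<Rightarrow> (nat \<Rightarrow> complex) \<Rightarrow> (nat \<Rightarrow> nat \<Rightarrow> complex) \<Rightarrow> nat
     \<Rightarrow> (nat \<Rightarrow> complex) \<Rightarrow> (nat \<Rightarrow> complex) \<Rightarrow> complex" where
  "soliton_num \<sigma> N lam c s p q = fdet (Suc N) (pq_bordered \<sigma> N lam c s p q)"

lemma cauchy_entry_eq:
  "cauchy_entry \<sigma> lam c i j
    = cnj (zpar lam i) * zpar lam j * gam \<sigma> c i j / (zpar lam j - cnj (zpar lam i))"
proof -
  have "(\<Sum>s\<in>{1, 2}. cnj (cvec lam c i s) * Lambda_diag \<sigma> s * cvec lam c j s)
      = cnj (zpar lam i) * zpar lam j * gam \<sigma> c i j"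
    by (simp add: Lambda_diag_def cvec_def gam_def algebra_simps)
  then show ?thesis by (simp add: cauchy_entry_def)
qed

lemma M_entry_eq:
  "M_entry \<sigma> lam c x t i j
    = pq_entry \<sigma> lam c (\<lambda>j. exp (theta lam j x t)) (\<lambda>j. exp (- theta lam j x t)) i j"
proof -
  have "exp (cnj (theta lam i x t) + theta lam j x t)
      = cnj (exp (theta lam i x t)) * exp (theta lam j x t)"
    "exp (- cnj (theta lam i x t) - theta lam j x t)
      = cnj (exp (- theta lam i x t)) * exp (- theta lam j x t)"
    by (simp_all add: exp_add exp_diff exp_minus exp_cnj field_simps)
  then show ?thesis
    by (simp add: M_entry_def pq_entry_def grow_coef_def decay_coef_def cauchy_entry_eq algebra_simps
        add_divide_distrib)
qed

text \<open>Row \<open>i\<close> acquires the factor \<open>cnj (r i)\<close> and column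
  \<open>j\<close> the factor \<open>r j\<close>. The border entries scale in the same way and the
  border itself has factor 1, so numerator and denominator change by the same nonzero
  product.\<close>

lemma u_soliton_eq_num_den:
  assumes "\<And>j. r j \<noteq> 0"
    and p_def: "p = (\<lambda>j. r j * exp (theta lam j x t))"
    and q_def: "q = (\<lambda>j. r j * exp (- theta lam j x t))"
  shows "u_soliton \<sigma> N lam c s x t = - 2 * soliton_num \<sigma> N lam c s p q / soliton_den \<sigma> N lam c p q"
proof -
  define p' q' where "p' = (\<lambda>j. exp (theta lam j x t))" and "q' = (\<lambda>j. exp (- theta lam j x t))"
  define a b where "a = (\<lambda>i. if i < N then cnj (r (Suc i)) else 1)"
    and "b = (\<lambda>j. if j < N then r (Suc j) else 1)"
  have pq: "pq_entry \<sigma> lam c p q i j = cnj (r i) * r j * pq_entry \<sigma> lam c p' q' i j" for i j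
    by (simp add: pq_entry_def p_def q_def p'_def q'_def algebra_simps)
  have "soliton_den \<sigma> N lam c p q = fdet N (\<lambda>i j. a i * b j * pq_entry \<sigma> lam c p' q' (Suc i) (Suc j))"
    unfolding soliton_den_def pq by (rule fdet_cong) (auto simp: a_def b_def)
  then have soliton_den: "soliton_den \<sigma> N lam c p q = (\<Prod>i<N. a i) * (\<Prod>j<N. b j) * soliton_den \<sigma> N lam c p' q'"
    unfolding fdet_scale soliton_den_def .
  have "soliton_num \<sigma> N lam c s p q = fdet (Suc N) (\<lambda>i j. a i * b j * pq_bordered \<sigma> N lam c s p' q' i j)"
    unfolding soliton_num_def
    by (rule fdet_cong)
      (auto simp: pq_bordered_def a_def b_def pq p_def[THEN fun_cong] q_def[THEN fun_cong] p'_def q'_def)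
  also have "\<dots> = (\<Prod>i<Suc N. a i) * (\<Prod>j<Suc N. b j) * soliton_num \<sigma> N lam c s p' q'"
    unfolding fdet_scale soliton_num_def ..
  also have "\<dots> = (\<Prod>i<N. a i) * (\<Prod>j<N. b j) * soliton_num \<sigma> N lam c s p' q'"
    by (simp add: a_def b_def)
  finally have soliton_num: "soliton_num \<sigma> N lam c s p q = (\<Prod>i<N. a i) * (\<Prod>j<N. b j) * soliton_num \<sigma> N lam c s p' q'" .
  have nz: "(\<Prod>i<N. a i) * (\<Prod>j<N. b j) \<noteq> 0"
    using assms(1) by (simp add: a_def b_def)
  have "four_block_mat (M_mat \<sigma> N lam c x t) (Y1_dagger N lam x t)
      (Y2_row N lam c s x t) (0\<^sub>m 1 1)
      = mat (Suc N) (Suc N) (\<lambda>(i, j). pq_bordered \<sigma> N lam c s p' q' i j)"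
    by (rule eq_matI)
      (auto simp: M_mat_def Y1_dagger_def Y2_row_def pq_bordered_def M_entry_eq p'_def q'_def)
  then have "soliton_num \<sigma> N lam c s p' q' = det (four_block_mat (M_mat \<sigma> N lam c x t)
      (Y1_dagger N lam x t) (Y2_row N lam c s x t) (0\<^sub>m 1 1))"
    by (simp add: soliton_num_def fdet_def)
  moreover have "soliton_den \<sigma> N lam c p' q' = det (M_mat \<sigma> N lam c x t)"
    by (simp add: soliton_den_def fdet_def M_mat_def M_entry_eq p'_def q'_def)
  ultimately show ?thesis
    using nz by (simp add: u_soliton_def soliton_num soliton_den)
qed

section \<open>Cauchy-type evaluation of the limit determinants\<close>

definition det_grow_up :: "nat \<Rightarrow> (nat \<Rightarrow> complex) \<Rightarrow> nat \<Rightarrow> complex" where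
  "det_grow_up N lam k = fdet (Suc N - k) (\<lambda>i j. grow_coef lam (k + i) (k + j))"

text \<open>The exponential of the sum of logarithms in \<open>theta_minus\<close>, free of any
  choice of branch.\<close>

definition shift_factor :: "nat \<Rightarrow> (nat \<Rightarrow> complex) \<Rightarrow> nat \<Rightarrow> complex" where
  "shift_factor N lam k
     = (\<Prod>j=k+1..N. (zpar lam j - zpar lam k) / (cnj (zpar lam j) - zpar lam k))"

text \<open>Denominator of the one-soliton formula in homogeneous form, with \<open>P\<close> and
  \<open>Q\<close> in the roles of \<open>exp \<theta>\<close> and \<open>exp (- \<theta>)\<close>.
  In \<open>profile\<close>, a common nonzero factor of \<open>P\<close> and \<open>Q\<close>
  cancels.\<close>

definition profile_den ::
    "real \<Rightarrow> nat \<Rightarrow> (nat \<Rightarrow> complex) \<Rightarrow> (nat \<Rightarrow> nat \<Rightarrow> complex) \<Rightarrow> nat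
     \<Rightarrow> complex \<Rightarrow> complex \<Rightarrow> complex" where
  "profile_den \<sigma> N lam c k P Q =
     lam k * of_real ((cmod P)\<^sup>2 * (cmod (shift_factor N lam k))\<^sup>2)
     + cnj (lam k) * delta_minus \<sigma> lam c k * of_real ((cmod Q)\<^sup>2)"

definition profile ::
    "real \<Rightarrow> nat \<Rightarrow> (nat \<Rightarrow> complex) \<Rightarrow> (nat \<Rightarrow> nat \<Rightarrow> complex) \<Rightarrow> nat \<Rightarrow> nat
     \<Rightarrow> complex \<Rightarrow> complex \<Rightarrow> complex" where
  "profile \<sigma> N lam c s k P Q =
     chat_minus \<sigma> N lam c s k * zratio lam k * (cnj (shift_factor N lam k) * (cnj P * Q))
     / profile_den \<sigma> N lam c k P Q"

text \<open>Limit values near soliton \<open>k\<close>: solitons of smaller index keep only their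
  \<open>q\<close>, those of larger index only their \<open>p\<close>.\<close>

definition p_lim :: "nat \<Rightarrow> complex \<Rightarrow> nat \<Rightarrow> complex" where
  "p_lim k P j = (if j < k then 0 else if j = k then P else 1)"

definition q_lim :: "nat \<Rightarrow> complex \<Rightarrow> nat \<Rightarrow> complex" where
  "q_lim k Q j = (if j < k then 1 else if j = k then Q else 0)"

text \<open>Only distinctness of the \<open>zpar lam i\<close> is assumed, not an order of the
  velocities, so that the locale can also be instantiated with the reversed numbering.\<close>

locale solitons =
  fixes \<sigma> :: real and N :: nat and lam :: "nat \<Rightarrow> complex" and c :: "nat \<Rightarrow> nat \<Rightarrow> complex"
  assumes lam_nz: "i \<in> {1..N} \<Longrightarrow> Re (lam i) \<noteq> 0 \<and> Im (lam i) \<noteq> 0"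
    and Im_z: "i \<in> {1..N} \<Longrightarrow> Im (zpar lam i) < 0"
    and z_inj: "inj_on (zpar lam) {1..N}"
begin

abbreviation z where "z \<equiv> zpar lam"
abbreviation E where "E \<equiv> grow_coef lam"
abbreviation F where "F \<equiv> decay_coef \<sigma> lam c"

lemma z_nz: "i \<in> {1..N} \<Longrightarrow> z i \<noteq> 0"
  using Im_z[of i] by auto

lemma lam_nz': "i \<in> {1..N} \<Longrightarrow> lam i \<noteq> 0"
  using lam_nz[of i] by auto

lemma z_minus_cnj: "i \<in> {1..N} \<Longrightarrow> j \<in> {1..N} \<Longrightarrow> z j - cnj (z i) \<noteq> 0"
  using Im_z[of i] Im_z[of j] by (auto simp: complex_eq_iff)

lemma cnj_minus_z: "i \<in> {1..N} \<Longrightarrow> j \<in> {1..N} \<Longrightarrow> cnj (z i) - z j \<noteq> 0"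
  using z_minus_cnj[of i j] by auto

lemma z_minus_z: "i \<in> {1..N} \<Longrightarrow> j \<in> {1..N} \<Longrightarrow> i \<noteq> j \<Longrightarrow> z j - z i \<noteq> 0"
  using z_inj by (auto dest: inj_onD)

lemma zratio_nz: "k \<in> {1..N} \<Longrightarrow> zratio lam k \<noteq> 0"
  using z_minus_cnj[of k k] z_nz[of k] by (simp add: zratio_def)

lemma shift_factor_nz: "k \<in> {1..N} \<Longrightarrow> shift_factor N lam k \<noteq> 0"
  unfolding shift_factor_def
  by (subst prod_zero_iff) (use z_minus_z cnj_minus_z in \<open>auto simp: algebra_simps\<close>)

lemma E_diag: "k \<in> {1..N} \<Longrightarrow> E k k = 2 * lam k / zratio lam k"
  by (simp add: grow_coef_def zratio_def complex_norm_square[symmetric] mult_ac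
      del: of_real_power)

lemma prod_shift:
  assumes "Suc m + n = N"
  shows "(\<Prod>i<n. g (Suc (Suc m) + i)) = (\<Prod>j=Suc m + 1..N. g j)"
proof (rule prod.reindex_bij_witness[where i = "\<lambda>j. j - Suc (Suc m)" and j = "\<lambda>i. Suc (Suc m) + i"])
qed (use assms in auto)

text \<open>Cauchy's determinant by elimination: the Schur complement of the entry of soliton
  \<open>k\<close> is the remaining matrix with its rows and columns rescaled, and these scale
  factors multiply to the squared modulus of the shift factor.\<close>

lemma det_grow_up_rec:
  assumes "k \<in> {1..N}"
  shows "det_grow_up N lam k = E k k * of_real ((cmod (shift_factor N lam k))\<^sup>2) * det_grow_up N lam (Suc k)"
proof -
  obtain m where k: "k = Suc m" using assms by (cases k) auto
  obtain n where n: "Suc m + n = N" using assms k by (metis atLeastAtMost_iff le_Suc_ex)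
  have N_k: "Suc N - k = Suc n" "Suc N - Suc k = n" using n k by auto
  have in_range: "k + i \<in> {1..N}" if "i \<le> n" for i using that n k by auto
  define a where "a = (\<lambda>j. (z k - z j) / (z j - cnj (z k)))"
  define b where "b = (\<lambda>i. (cnj (z i) - cnj (z k)) / (z k - cnj (z i)))"
  have Ekk: "E k k \<noteq> 0"
    using assms z_nz[of k] lam_nz'[of k] z_minus_cnj[of k k] by (simp add: grow_coef_def)
  have "det_grow_up N lam k = fdet (Suc n) (\<lambda>i j. E (k + i) (k + j))"
    by (simp add: det_grow_up_def N_k)
  also have "\<dots> = E k k * fdet n (\<lambda>i j. E (k + Suc i) (k + Suc j)
      - E (k + Suc i) k * E k (k + Suc j) / E k k)"
    using fdet_schur[of "\<lambda>i j. E (k + i) (k + j)" n] Ekk by simp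
  also have "fdet n (\<lambda>i j. E (k + Suc i) (k + Suc j) - E (k + Suc i) k * E k (k + Suc j) / E k k)
      = fdet n (\<lambda>i j. b (k + Suc i) * a (k + Suc j) * E (k + Suc i) (k + Suc j))"
  proof (rule fdet_cong[OF refl])
    fix i j assume "i < n" "j < n"
    then have ir: "k + Suc i \<in> {1..N}" "k + Suc j \<in> {1..N}" using in_range[of "Suc i"] in_range[of "Suc j"] by auto
    define zi zj where "zi = cnj (z (k + Suc i))" and "zj = z (k + Suc j)"
    define zk zk' where "zk = z k" and "zk' = cnj (z k)"
    have nz: "zj - zi \<noteq> 0" "zk - zi \<noteq> 0" "zj - zk' \<noteq> 0" "zk - zk' \<noteq> 0" "zk \<noteq> 0" "zk' \<noteq> 0"
        "lam k \<noteq> 0"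
      unfolding zi_def zj_def zk_def zk'_def
      using z_minus_cnj[OF ir] z_minus_cnj[OF ir(1) assms] z_minus_cnj[OF assms ir(2)]
        z_minus_cnj[OF assms assms] z_nz[OF assms] lam_nz'[OF assms] by auto
    let ?l = "lam (k + Suc j)"
    have "(2 * zi * zk * lam k / A) * (2 * zk' * zj * ?l / B) / (2 * zk' * zk * lam k / C)
        = 2 * zi * zj * ?l * (C / (A * B))" for A B C :: complex
      using nz(5-7) by simp
    then have "2 * zi * zj * ?l / (zj - zi)
        - (2 * zi * zk * lam k / (zk - zi)) * (2 * zk' * zj * ?l / (zj - zk'))
          / (2 * zk' * zk * lam k / (zk - zk'))
      = 2 * zi * zj * ?l * (1 / (zj - zi) - (zk - zk') / ((zk - zi) * (zj - zk')))"
      by (simp only: right_diff_distrib) simp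
    \<comment> \<open>The rational identity behind Cauchy's determinant; all factors other than the
      differences have been cancelled before.\<close>
    also have "1 / (zj - zi) - (zk - zk') / ((zk - zi) * (zj - zk'))
      = (zi - zk') / (zk - zi) * ((zk - zj) / (zj - zk')) / (zj - zi)"
      using nz by (simp add: divide_simps) (simp add: algebra_simps)
    finally show "E (k + Suc i) (k + Suc j) - E (k + Suc i) k * E k (k + Suc j) / E k k
        = b (k + Suc i) * a (k + Suc j) * E (k + Suc i) (k + Suc j)"
      unfolding grow_coef_def a_def b_def zi_def zj_def zk_def zk'_def by (simp add: mult_ac)
  qed
  also have "\<dots> = (\<Prod>i<n. b (Suc k + i)) * (\<Prod>i<n. a (Suc k + i)) * det_grow_up N lam (Suc k)"
    unfolding fdet_scale by (simp only: det_grow_up_def N_k add_Suc_right add_Suc)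
  also have "(\<Prod>i<n. b (Suc k + i)) * (\<Prod>i<n. a (Suc k + i)) = (\<Prod>j=k+1..N. b j * a j)"
    unfolding k prod_shift[OF n] prod.distrib ..
  also have "\<dots> = (\<Prod>j=k+1..N. (z j - z k) / (cnj (z j) - z k)
      * cnj ((z j - z k) / (cnj (z j) - z k)))"
  proof (rule prod.cong[OF refl])
    fix j assume "j \<in> {k+1..N}"
    then have j: "j \<in> {1..N}" by auto
    show "b j * a j = (z j - z k) / (cnj (z j) - z k) * cnj ((z j - z k) / (cnj (z j) - z k))"
      using z_minus_cnj[OF j assms] cnj_minus_z[OF j assms] z_minus_cnj[OF assms j]
      unfolding a_def b_def by (simp add: divide_simps) (simp add: algebra_simps)
  qed
  also have "\<dots> = shift_factor N lam k * cnj (shift_factor N lam k)"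
    unfolding shift_factor_def prod.distrib by simp
  also have "\<dots> = of_real ((cmod (shift_factor N lam k))\<^sup>2)"
    by (rule complex_norm_square[symmetric])
  finally show ?thesis by (simp add: mult_ac)
qed

lemma det_grow_up_nz:
  assumes "k \<in> {1..Suc N}"
  shows "det_grow_up N lam k \<noteq> 0"
proof -
  have "k \<le> Suc N" "1 \<le> k" using assms by auto
  then show ?thesis
  proof (induction k rule: inc_induct)
    case base
    show ?case by (simp add: det_grow_up_def)
  next
    case (step k)
    have k: "k \<in> {1..N}" using step by auto
    have "E k k \<noteq> 0" using E_diag[OF k] lam_nz'[OF k] zratio_nz[OF k] by simp
    then show ?case
      using det_grow_up_rec[OF k] step shift_factor_nz[OF k] by simp
  qed
qed

text \<open>This block appears in the numerator, where the border column takes the place of column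
  \<open>k\<close>. Elimination with pivot 1 again only rescales rows and columns; besides the
  conjugate shift factor it leaves the quotients \<open>z j / cnj (z j)\<close>, which are the
  unimodular factors in \<open>chat_minus\<close>.\<close>

lemma det_grow_up_ones:
  assumes "k \<in> {1..N}"
  shows "fdet (Suc N - k) (\<lambda>i j. if j = 0 then 1 else E (k + i) (k + j))
    = cnj (shift_factor N lam k) * (\<Prod>j=k+1..N. (z j)\<^sup>2 / of_real ((cmod (z j))\<^sup>2))
      * det_grow_up N lam (Suc k)"
proof -
  obtain m where k: "k = Suc m" using assms by (cases k) auto
  obtain n where n: "Suc m + n = N" using assms k by (metis atLeastAtMost_iff le_Suc_ex)
  have N_k: "Suc N - k = Suc n" "Suc N - Suc k = n" using n k by auto
  have in_range: "k + i \<in> {1..N}" if "i \<le> n" for i using that n k by auto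
  define a where "a = (\<lambda>j. z j / (z j - cnj (z k)))"
  define b where "b = (\<lambda>i. (cnj (z i) - cnj (z k)) / cnj (z i))"
  have "fdet (Suc N - k) (\<lambda>i j. if j = 0 then 1 else E (k + i) (k + j))
      = fdet (Suc n) (\<lambda>i j. if j = 0 then 1 else E (k + i) (k + j))"
    by (simp only: N_k)
  also have "\<dots> = fdet n (\<lambda>i j. E (k + Suc i) (k + Suc j) - E k (k + Suc j))"
    using fdet_schur[of "\<lambda>i j. if j = 0 then 1 else E (k + i) (k + j)" n] by simp
  also have "\<dots> = fdet n (\<lambda>i j. b (k + Suc i) * a (k + Suc j) * E (k + Suc i) (k + Suc j))"
  proof (rule fdet_cong[OF refl])
    fix i j assume "i < n" "j < n"
    then have ir: "k + Suc i \<in> {1..N}" "k + Suc j \<in> {1..N}" using in_range[of "Suc i"] in_range[of "Suc j"] by auto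
    define zi zj where "zi = cnj (z (k + Suc i))" and "zj = z (k + Suc j)"
    define zk' where "zk' = cnj (z k)"
    have nz: "zj - zi \<noteq> 0" "zj - zk' \<noteq> 0" "zi \<noteq> 0"
      unfolding zi_def zj_def zk'_def
      using z_minus_cnj[OF ir] z_minus_cnj[OF assms ir(2)] z_nz[OF ir(1)] by auto
    let ?l = "lam (k + Suc j)"
    have "2 * zi * zj * ?l / (zj - zi) - 2 * zk' * zj * ?l / (zj - zk')
      = (zi - zk') / zi * (zj / (zj - zk')) * (2 * zi * zj * ?l / (zj - zi))"
      using nz by (simp add: divide_simps) (simp add: algebra_simps)
    then show "E (k + Suc i) (k + Suc j) - E k (k + Suc j)
        = b (k + Suc i) * a (k + Suc j) * E (k + Suc i) (k + Suc j)"
      unfolding grow_coef_def a_def b_def zi_def zj_def zk'_def .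
  qed
  also have "\<dots> = (\<Prod>i<n. b (Suc k + i)) * (\<Prod>i<n. a (Suc k + i)) * det_grow_up N lam (Suc k)"
    unfolding fdet_scale by (simp only: det_grow_up_def N_k add_Suc_right add_Suc)
  also have "(\<Prod>i<n. b (Suc k + i)) * (\<Prod>i<n. a (Suc k + i)) = (\<Prod>j=k+1..N. b j * a j)"
    unfolding k prod_shift[OF n] prod.distrib ..
  also have "\<dots> = (\<Prod>j=k+1..N. cnj ((z j - z k) / (cnj (z j) - z k))
      * ((z j)\<^sup>2 / of_real ((cmod (z j))\<^sup>2)))"
  proof (rule prod.cong[OF refl])
    fix j assume "j \<in> {k+1..N}"
    then have j: "j \<in> {1..N}" by auto
    show "b j * a j = cnj ((z j - z k) / (cnj (z j) - z k)) * ((z j)\<^sup>2 / of_real ((cmod (z j))\<^sup>2))"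
      using z_minus_cnj[OF assms j] z_nz[OF j]
      unfolding a_def b_def complex_norm_square by (simp add: power2_eq_square)
  qed
  also have "\<dots> = cnj (shift_factor N lam k) * (\<Prod>j=k+1..N. (z j)\<^sup>2 / of_real ((cmod (z j))\<^sup>2))"
    unfolding shift_factor_def prod.distrib by simp
  finally show ?thesis .
qed

text \<open>The row factors by which the matrix of the \<open>F i j\<close> differs from the Cauchy
  matrix.\<close>

definition lam_prod :: "nat \<Rightarrow> complex" where
  "lam_prod m = (\<Prod>i<m. 2 * cnj (lam (Suc i)))"

lemma fdet_F: "fdet m (\<lambda>i j. F (Suc i) (Suc j)) = lam_prod m * det (C_low \<sigma> lam c m)"
  using fdet_scale[of m "\<lambda>i. 2 * cnj (lam (Suc i))" "\<lambda>_. 1"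
      "\<lambda>i j. cauchy_entry \<sigma> lam c (Suc i) (Suc j)"]
  by (simp add: decay_coef_def lam_prod_def C_low_def fdet_def)

text \<open>At the limit values all rows but that of soliton \<open>k\<close> are purely growing or
  purely decaying. Splitting this row gives two block triangular matrices, in which soliton
  \<open>k\<close> belongs to the growing and to the decaying block respectively.\<close>

lemma soliton_den_limit:
  assumes "k \<in> {1..N}"
  shows "soliton_den \<sigma> N lam c (p_lim k P) (q_lim k Q)
    = of_real ((cmod P)\<^sup>2) * (lam_prod (k - 1) * det (C_low \<sigma> lam c (k - 1)) * det_grow_up N lam k)
      + of_real ((cmod Q)\<^sup>2) * (lam_prod k * det (C_low \<sigma> lam c k) * det_grow_up N lam (Suc k))"
proof -
  obtain m where k: "k = Suc m" using assms by (cases k) auto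
  obtain n where n: "Suc m + n = N" using assms k by (metis atLeastAtMost_iff le_Suc_ex)
  define p q where "p = (\<lambda>j. p_lim k P (Suc j))" and "q = (\<lambda>j. q_lim k Q (Suc j))"
  define h where "h = (\<lambda>i j. pq_entry \<sigma> lam c (p_lim k P) (q_lim k Q) (Suc i) (Suc j))"
  define ra where "ra = (\<lambda>j. cnj P * (E (Suc m) (Suc j) * p j))"
  define rb where "rb = (\<lambda>j. cnj Q * (F (Suc m) (Suc j) * q j))"
  have h: "h i j = E (Suc i) (Suc j) * (cnj (p i) * p j) + F (Suc i) (Suc j) * (cnj (q i) * q j)" for i j
    by (simp add: h_def pq_entry_def p_def q_def)
  have p: "p i = (if i < m then 0 else if i = m then P else 1)" for i
    by (simp add: p_def p_lim_def k)
  have q: "q i = (if i < m then 1 else if i = m then Q else 0)" for i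
    by (simp add: q_def q_lim_def k)
  have "soliton_den \<sigma> N lam c (p_lim k P) (q_lim k Q)
      = fdet N (\<lambda>i j. if i = m then ra j + rb j else h i j)"
    unfolding soliton_den_def h_def[symmetric]
    by (rule fdet_cong) (auto simp: h p q ra_def rb_def)
  also have "\<dots> = fdet N (\<lambda>i j. if i = m then ra j else h i j)
      + fdet N (\<lambda>i j. if i = m then rb j else h i j)"
    by (rule fdet_row_add) (use n in auto)
  also have "fdet N (\<lambda>i j. if i = m then ra j else h i j)
      = fdet (m + Suc n) (\<lambda>i j. if i = m then ra j else h i j)"
    by (rule fdet_cong) (use n in auto)
  \<comment> \<open>Rows from \<open>m\<close> on now contain only growing terms, and
    \<open>p\<close> vanishes in the columns before \<open>m\<close>.\<close>
  also have "\<dots> = fdet m (\<lambda>i j. if i = m then ra j else h i j)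
      * fdet (Suc n) (\<lambda>i j. if m + i = m then ra (m + j) else h (m + i) (m + j))"
    by (rule fdet_block_lower_left_zero) (auto simp: h p q ra_def)
  also have "fdet m (\<lambda>i j. if i = m then ra j else h i j) = fdet m (\<lambda>i j. F (Suc i) (Suc j))"
    by (rule fdet_cong) (auto simp: h p q)
  also have "fdet (Suc n) (\<lambda>i j. if m + i = m then ra (m + j) else h (m + i) (m + j))
      = fdet (Suc n) (\<lambda>i j. cnj (p (m + i)) * p (m + j) * E (k + i) (k + j))"
    by (rule fdet_cong) (auto simp: h p q ra_def k)
  also have "\<dots> = (\<Prod>i<Suc n. cnj (p (m + i))) * (\<Prod>i<Suc n. p (m + i)) * det_grow_up N lam k"
    unfolding fdet_scale using n by (simp add: det_grow_up_def k flip: n)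
  also have "(\<Prod>i<Suc n. p (m + i)) = P" unfolding prod.lessThan_Suc_shift by (simp add: p)
  also have "(\<Prod>i<Suc n. cnj (p (m + i))) = cnj P" unfolding prod.lessThan_Suc_shift by (simp add: p)
  also have "fdet N (\<lambda>i j. if i = m then rb j else h i j)
      = fdet (Suc m + n) (\<lambda>i j. if i = m then rb j else h i j)"
    by (rule fdet_cong) (use n in auto)
  \<comment> \<open>Rows up to \<open>m\<close> now contain only decaying terms, and
    \<open>q\<close> vanishes in the columns after \<open>m\<close>.\<close>
  also have "\<dots> = fdet (Suc m) (\<lambda>i j. if i = m then rb j else h i j)
      * fdet n (\<lambda>i j. if Suc m + i = m then rb (Suc m + j) else h (Suc m + i) (Suc m + j))"
    by (rule fdet_block_upper_right_zero) (auto simp: h p q rb_def)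
  also have "fdet n (\<lambda>i j. if Suc m + i = m then rb (Suc m + j) else h (Suc m + i) (Suc m + j))
      = det_grow_up N lam (Suc k)"
    unfolding det_grow_up_def by (rule fdet_cong) (use n in \<open>auto simp: h p q k\<close>)
  also have "fdet (Suc m) (\<lambda>i j. if i = m then rb j else h i j)
      = fdet (Suc m) (\<lambda>i j. cnj (q i) * q j * F (Suc i) (Suc j))"
    by (rule fdet_cong) (auto simp: h p q rb_def)
  also have "\<dots> = (\<Prod>i<Suc m. cnj (q i)) * (\<Prod>i<Suc m. q i) * fdet k (\<lambda>i j. F (Suc i) (Suc j))"
    unfolding fdet_scale k ..
  also have "(\<Prod>i<Suc m. q i) = Q" by (simp add: q)
  also have "(\<Prod>i<Suc m. cnj (q i)) = cnj Q" by (simp add: q)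
  finally show ?thesis
    unfolding fdet_F complex_norm_square by (simp add: k mult_ac)
qed

text \<open>After rearrangement the upper block consists of the decaying rows before
  \<open>k\<close> and the border row, which is \<open>Chat_low\<close> up to scaling. The lower
  block consists of the border column and the growing columns after \<open>k\<close>, as in
  \<open>det_grow_up_ones\<close>.\<close>

lemma soliton_num_limit:
  assumes "k \<in> {1..N}"
  shows "soliton_num \<sigma> N lam c s (p_lim k P) (q_lim k Q)
    = - (cnj P * Q * lam_prod (k - 1) * det (Chat_low \<sigma> lam c s k)
         * (cnj (shift_factor N lam k) * (\<Prod>j=k+1..N. (z j)\<^sup>2 / of_real ((cmod (z j))\<^sup>2))
            * det_grow_up N lam (Suc k)))"
proof -
  obtain m where k: "k = Suc m" using assms by (cases k) auto
  obtain n where n: "Suc m + n = N" using assms k by (metis atLeastAtMost_iff le_Suc_ex)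
  define p q where "p = (\<lambda>j. p_lim k P (Suc j))" and "q = (\<lambda>j. q_lim k Q (Suc j))"
  define h where "h = pq_bordered \<sigma> N lam c s (p_lim k P) (q_lim k Q)"
  have h: "h i j = (if i < N then if j < N then E (Suc i) (Suc j) * (cnj (p i) * p j)
      + F (Suc i) (Suc j) * (cnj (q i) * q j) else cnj (p i)
      else if j < N then c (Suc j) s * q j else 0)" for i j
    by (simp add: h_def pq_bordered_def pq_entry_def p_def q_def)
  have p: "p i = (if i < m then 0 else if i = m then P else 1)" for i
    by (simp add: p_def p_lim_def k)
  have q: "q i = (if i < m then 1 else if i = m then Q else 0)" for i
    by (simp add: q_def q_lim_def k)
  \<comment> \<open>Moving the border to position \<open>m\<close> leaves the determinant unchanged; exchanging then its
    column with that of soliton \<open>k\<close> changes the sign and makes the matrix block triangular.\<close>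
  define \<rho> where "\<rho> = (\<lambda>i. if i < m then i else if i = m then N else if i \<le> N then i - 1 else i)"
  define \<tau> where "\<tau> = Transposition.transpose m (Suc m)"
  have "bij_betw \<rho> {0..<Suc N} {0..<Suc N}"
    by (rule bij_betwI[where g = "\<lambda>i. if i < m then i else if i = N then m else Suc i"])
      (use n in \<open>auto simp: \<rho>_def\<close>)
  then have \<rho>: "\<rho> permutes {0..<Suc N}"
    by (rule bij_imp_permutes) (use n in \<open>auto simp: \<rho>_def\<close>)
  have \<tau>: "\<tau> permutes {0..<Suc N}"
    unfolding \<tau>_def by (rule permutes_swap_id) (use n in auto)
  define \<kappa> where "\<kappa> = \<rho> \<circ> \<tau>"
  have \<kappa>: "\<kappa> permutes {0..<Suc N}" unfolding \<kappa>_def by (rule permutes_compose[OF \<tau> \<rho>])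
  have "signof \<kappa> = (signof \<rho> * signof \<tau> :: complex)"
    unfolding \<kappa>_def by (rule signof_compose[OF \<rho> \<tau>])
  moreover have "signof \<tau> = (- 1 :: complex)"
    by (simp add: \<tau>_def sign_swap_id)
  moreover have "signof \<rho> * signof \<rho> = (1 :: complex)"
    using signof_pm_one[of \<rho>, where ?'a = complex] by auto
  ultimately have sign: "signof \<rho> * signof \<kappa> = (- 1 :: complex)" by simp
  define g where "g = (\<lambda>i j. h (\<rho> i) (\<kappa> j))"
  have col: "\<kappa> j = (if j \<le> m then j else if j = Suc m then N else if j \<le> N then j - 1 else j)" for j
    using n by (auto simp: \<kappa>_def \<rho>_def \<tau>_def Transposition.transpose_def)
  have "fdet (Suc N) g = signof \<rho> * signof \<kappa> * fdet (Suc N) h"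
    unfolding g_def by (rule fdet_permute[OF \<rho> \<kappa>])
  then have "soliton_num \<sigma> N lam c s (p_lim k P) (q_lim k Q) = - fdet (Suc N) g"
    unfolding sign soliton_num_def h_def by simp
  also have "fdet (Suc N) g = fdet (Suc m + Suc n) g"
    by (rule fdet_cong) (use n in auto)
  also have "\<dots> = fdet (Suc m) g * fdet (Suc n) (\<lambda>i j. g (Suc m + i) (Suc m + j))"
    by (rule fdet_block_upper_right_zero) (use n in \<open>auto simp: g_def col \<rho>_def h p q\<close>)
  also have "fdet (Suc m) g = fdet (Suc m) (\<lambda>i j. (if i < m then 2 * cnj (lam (Suc i)) else 1) * q j
      * (if i + 1 < k then cauchy_entry \<sigma> lam c (i + 1) (j + 1) else c (j + 1) s))"
    by (rule fdet_cong) (use n in \<open>auto simp: g_def col \<rho>_def h p q k decay_coef_def\<close>)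
  also have "\<dots> = (\<Prod>i<Suc m. if i < m then 2 * cnj (lam (Suc i)) else 1) * (\<Prod>j<Suc m. q j)
      * det (Chat_low \<sigma> lam c s k)"
    unfolding fdet_scale by (simp add: Chat_low_def fdet_def k)
  also have "(\<Prod>j<Suc m. q j) = Q" by (simp add: q)
  also have "(\<Prod>i<Suc m. if i < m then 2 * cnj (lam (Suc i)) else 1) = lam_prod (k - 1)"
    by (simp add: lam_prod_def k)
  also have "fdet (Suc n) (\<lambda>i j. g (Suc m + i) (Suc m + j))
      = fdet (Suc n) (\<lambda>i j. cnj (p (m + i)) * 1 * (if j = 0 then 1 else E (k + i) (k + j)))"
    by (rule fdet_cong) (use n in \<open>auto simp: g_def col \<rho>_def h p q k\<close>)
  also have "\<dots> = (\<Prod>i<Suc n. cnj (p (m + i))) * (\<Prod>j<Suc n. 1)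
      * fdet (Suc N - k) (\<lambda>i j. if j = 0 then 1 else E (k + i) (k + j))"
    unfolding fdet_scale using n by (simp add: k flip: n)
  also have "(\<Prod>i<Suc n. cnj (p (m + i))) = cnj P" unfolding prod.lessThan_Suc_shift by (simp add: p)
  finally show ?thesis unfolding det_grow_up_ones[OF assms] by (simp add: mult_ac)
qed

text \<open>The recursion for \<open>det_grow_up\<close> and the quotient of Cauchy determinants in
  \<open>delta_minus\<close> expose a factor common to both terms. Its \<open>P\<close>- and
  \<open>Q\<close>-free constituents cancel against the numerator in the next lemmas.\<close>

lemma soliton_den_limit_profile:
  assumes "k \<in> {1..N}" "det (C_low \<sigma> lam c (k - 1)) \<noteq> 0"
  shows "soliton_den \<sigma> N lam c (p_lim k P) (q_lim k Q)
    = 2 / zratio lam k * lam_prod (k - 1) * det (C_low \<sigma> lam c (k - 1)) * det_grow_up N lam (Suc k)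
      * profile_den \<sigma> N lam c k P Q"
proof -
  have "lam_prod k = lam_prod (k - 1) * (2 * cnj (lam k))"
    using assms(1) by (cases k) (auto simp: lam_prod_def)
  then show ?thesis
    unfolding soliton_den_limit[OF assms(1)] profile_den_def delta_minus_def
      det_grow_up_rec[OF assms(1)] E_diag[OF assms(1)]
    using assms(2) zratio_nz[OF assms(1)] by (simp add: field_simps)
qed

lemma lam_prod_nz: "m \<le> N \<Longrightarrow> lam_prod m \<noteq> 0"
  using lam_nz' by (auto simp: lam_prod_def)

lemma profile_eq_limit:
  assumes "k \<in> {1..N}" "det (C_low \<sigma> lam c (k - 1)) \<noteq> 0"
  shows "profile \<sigma> N lam c s k P Q
    = - 2 * soliton_num \<sigma> N lam c s (p_lim k P) (q_lim k Q) / soliton_den \<sigma> N lam c (p_lim k P) (q_lim k Q)"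
proof -
  have "k - 1 \<le> N" "Suc k \<in> {1..Suc N}" using assms(1) by auto
  then show ?thesis
    unfolding soliton_den_limit_profile[OF assms] soliton_num_limit[OF assms(1)] profile_def chat_minus_def
    using assms(2) zratio_nz[OF assms(1)] lam_prod_nz[of "k - 1"] det_grow_up_nz[of "Suc k"]
    by (simp add: field_simps)
qed

text \<open>The profile has degree 0 in \<open>(P, Q)\<close>, so the normalization \<open>r\<close>
  is free; it is later chosen to bound both arguments.\<close>

lemma u_minus_eq_profile:
  assumes "k \<in> {1..N}" "r \<noteq> 0"
  shows "u_minus \<sigma> N lam c s k x t = profile \<sigma> N lam c s k
    (of_real r * exp (theta lam k x t)) (of_real r * exp (- theta lam k x t))"
proof -
  let ?\<theta> = "theta lam k x t" and ?S = "shift_factor N lam k"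
  have nz: "(zpar lam j - zpar lam k) / (cnj (zpar lam j) - zpar lam k) \<noteq> 0"
    if "j \<in> {k+1..N}" for j
    using z_minus_z[of k j] cnj_minus_z[of j k] assms(1) that by auto
  have "exp (2 * theta_minus N lam k x t) = exp (2 * ?\<theta>) * exp (\<Sum>j=k+1..N.
      ln ((zpar lam j - zpar lam k) / (cnj (zpar lam j) - zpar lam k)))"
    unfolding theta_minus_def by (simp add: distrib_left exp_add)
  also have "exp (\<Sum>j=k+1..N. ln ((zpar lam j - zpar lam k) / (cnj (zpar lam j) - zpar lam k))) = ?S"
    unfolding shift_factor_def by (subst exp_sum) (use nz in \<open>auto intro!: prod.cong simp: exp_Ln\<close>)
  finally have e: "exp (2 * theta_minus N lam k x t) = exp (2 * ?\<theta>) * ?S" .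
  have "exp (2 * cnj (theta_minus N lam k x t)) = cnj (exp (2 * theta_minus N lam k x t))"
    by (simp add: exp_cnj)
  then have e': "exp (2 * cnj (theta_minus N lam k x t)) = cnj (exp (2 * ?\<theta>)) * cnj ?S"
    unfolding e by simp
  define a where "a = exp ?\<theta>"
  have a: "a \<noteq> 0" "exp (- ?\<theta>) = 1 / a" "exp (2 * ?\<theta>) = a\<^sup>2"
    by (auto simp: a_def exp_minus exp_double field_simps)
  \<comment> \<open>This is the squared modulus of the second argument of \<open>profile\<close>, by
    which the fraction in \<open>u_minus\<close> gets expanded.\<close>
  define w where "w = of_real (r\<^sup>2) / (a * cnj a)"
  have w: "w \<noteq> 0" using a(1) assms(2) by (simp add: w_def)
  have q2: "of_real ((cmod (of_real r * (1 / a)))\<^sup>2) = w"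
    unfolding complex_norm_square w_def by (simp add: power2_eq_square)
  have p2: "of_real ((cmod (of_real r * a))\<^sup>2 * (cmod ?S)\<^sup>2) = w * (a\<^sup>2 * cnj (a\<^sup>2) * (?S * cnj ?S))"
    unfolding of_real_mult complex_norm_square w_def using a(1) by (simp add: power2_eq_square)
  have pq: "cnj (of_real r * a) * (of_real r * (1 / a)) = w * cnj (a\<^sup>2)"
    unfolding w_def using a(1) by (simp add: power2_eq_square)
  have "profile \<sigma> N lam c s k (of_real r * a) (of_real r * (1 / a))
      = chat_minus \<sigma> N lam c s k * zratio lam k * (w * (cnj (a\<^sup>2) * cnj ?S))
        / (w * (lam k * (cnj (a\<^sup>2) * cnj ?S * (a\<^sup>2 * ?S)) + cnj (lam k) * delta_minus \<sigma> lam c k))"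
    unfolding profile_def profile_den_def q2 p2 pq by (simp add: algebra_simps)
  also have "\<dots> = u_minus \<sigma> N lam c s k x t"
    unfolding u_minus_def distrib_left[of 2] exp_add e e' a(3) using w by simp
  finally show ?thesis by (simp add: a(2) a_def)
qed

lemma Re_theta: "k \<in> {1..N} \<Longrightarrow> Re (theta lam k x t) = \<bar>Im (z k)\<bar> * (x - vel lam k * t)"
proof -
  assume k: "k \<in> {1..N}"
  have "1 / (4 * z k) = cnj (z k) / of_real (4 * (cmod (z k))\<^sup>2)"
    unfolding of_real_mult complex_norm_square using z_nz[OF k] by simp
  then have "Im (1 / (4 * z k)) = - Im (z k) * vel lam k"
    by (simp only: Im_divide_of_real vel_def) simp
  moreover have "Re (theta lam k x t) = - (Im (z k) * x + Im (1 / (4 * z k)) * t)"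
    by (simp add: theta_def del: times_divide_eq_left)
  ultimately show ?thesis using Im_z[OF k] by (simp add: algebra_simps)
qed

section \<open>Skew-Hermitian symmetry and lower bounds for the one-soliton denominator\<close>

lemma cauchy_entry_cnj: "cnj (cauchy_entry \<sigma> lam c i j) = - cauchy_entry \<sigma> lam c j i"
proof -
  have "cnj (gam \<sigma> c i j) = gam \<sigma> c j i" by (simp add: gam_def algebra_simps)
  moreover have "cnj (z j) - z i = - (z i - cnj (z j))" by simp
  ultimately show ?thesis unfolding cauchy_entry_eq
    by (simp only: complex_cnj_divide complex_cnj_mult complex_cnj_cnj complex_cnj_diff
        divide_minus_right mult_ac)
qed

lemma cnj_det_C_low: "cnj (det (C_low \<sigma> lam c m)) = (- 1) ^ m * det (C_low \<sigma> lam c m)"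
proof -
  define h where "h = (\<lambda>i j. cauchy_entry \<sigma> lam c (Suc i) (Suc j))"
  have C: "det (C_low \<sigma> lam c m) = fdet m h"
    by (simp add: C_low_def fdet_def h_def)
  have "cnj (fdet m h) = fdet m (\<lambda>i j. (- 1) * 1 * h j i)"
    unfolding fdet_cnj h_def cauchy_entry_cnj by simp
  also have "\<dots> = (- 1) ^ m * fdet m h"
    unfolding fdet_scale fdet_transpose[of m h] by simp
  finally show ?thesis unfolding C .
qed

text \<open>The two Cauchy matrices are skew-Hermitian of consecutive orders, so conjugation changes
  the sign of the quotient of their determinants. It also changes the sign of
  \<open>zratio\<close>.\<close>

lemma delta_minus_real:
  assumes "k \<in> {1..N}"
  shows "delta_minus \<sigma> lam c k = of_real (Re (delta_minus \<sigma> lam c k))"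
proof -
  have "(- 1 :: complex) ^ k = - ((- 1) ^ (k - 1))"
    using assms by (cases k) auto
  moreover have "cnj (zratio lam k) = - zratio lam k"
    by (simp add: zratio_def minus_divide_left)
  moreover have "(- 1 :: complex) ^ (k - 1) \<noteq> 0" by simp
  ultimately have "cnj (delta_minus \<sigma> lam c k) = delta_minus \<sigma> lam c k"
    unfolding delta_minus_def complex_cnj_mult complex_cnj_divide cnj_det_C_low by simp
  then show ?thesis by (metis Reals_cnj_iff of_real_Re)
qed

text \<open>For real \<open>a\<close> and \<open>b\<close>, the number
  \<open>lam k * a + cnj (lam k) * b\<close> has real part \<open>Re (lam k) * (a + b)\<close> and
  imaginary part \<open>Im (lam k) * (a - b)\<close>. Together they control both \<open>a\<close>
  and \<open>b\<close>, whatever the sign of \<open>delta_minus\<close>.\<close>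

lemma profile_den_bound:
  assumes "k \<in> {1..N}" "det (C_low \<sigma> lam c (k - 1)) \<noteq> 0" "det (C_low \<sigma> lam c k) \<noteq> 0"
  obtains \<mu> where "\<mu> > 0"
    and "\<And>P Q. \<mu> * (cmod P)\<^sup>2 \<le> cmod (profile_den \<sigma> N lam c k P Q)"
    and "\<And>P Q. \<mu> * (cmod Q)\<^sup>2 \<le> cmod (profile_den \<sigma> N lam c k P Q)"
proof -
  define d where "d = Re (delta_minus \<sigma> lam c k)"
  define e where "e = (cmod (shift_factor N lam k))\<^sup>2"
  define \<nu> where "\<nu> = min \<bar>Re (lam k)\<bar> \<bar>Im (lam k)\<bar>"
  have \<delta>: "delta_minus \<sigma> lam c k = of_real d"
    unfolding d_def by (rule delta_minus_real[OF assms(1)])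
  have "delta_minus \<sigma> lam c k \<noteq> 0"
    using assms zratio_nz[OF assms(1)] by (simp add: delta_minus_def)
  then have d: "\<bar>d\<bar> > 0" using \<delta> by auto
  have e: "e > 0" using shift_factor_nz[OF assms(1)] by (simp add: e_def)
  have \<nu>: "\<nu> > 0" using lam_nz[OF assms(1)] by (simp add: \<nu>_def)
  have main: "\<nu> * ((cmod P)\<^sup>2 * e) \<le> cmod (profile_den \<sigma> N lam c k P Q)"
      "\<nu> * (\<bar>d\<bar> * (cmod Q)\<^sup>2) \<le> cmod (profile_den \<sigma> N lam c k P Q)" for P Q
  proof -
    define a b where "a = (cmod P)\<^sup>2 * e" and "b = d * (cmod Q)\<^sup>2"
    define y where "y = profile_den \<sigma> N lam c k P Q"
    have y: "y = lam k * of_real a + cnj (lam k) * of_real b"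
      by (simp add: y_def profile_den_def \<delta> a_def b_def e_def)
    have "\<nu> * \<bar>a + b\<bar> \<le> \<bar>Re (lam k)\<bar> * \<bar>a + b\<bar>" by (intro mult_right_mono) (auto simp: \<nu>_def)
    also have "\<dots> = \<bar>Re y\<bar>" by (simp add: y abs_mult[symmetric] algebra_simps)
    also have "\<dots> \<le> cmod y" by (rule abs_Re_le_cmod)
    finally have 1: "\<nu> * \<bar>a + b\<bar> \<le> cmod y" .
    have "\<nu> * \<bar>a - b\<bar> \<le> \<bar>Im (lam k)\<bar> * \<bar>a - b\<bar>" by (intro mult_right_mono) (auto simp: \<nu>_def)
    also have "\<dots> = \<bar>Im y\<bar>" by (simp add: y abs_mult[symmetric] algebra_simps)
    also have "\<dots> \<le> cmod y" by (rule abs_Im_le_cmod)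
    finally have 2: "\<nu> * \<bar>a - b\<bar> \<le> cmod y" .
    have "\<nu> * (2 * \<bar>a\<bar>) \<le> \<nu> * (\<bar>a + b\<bar> + \<bar>a - b\<bar>)"
      "\<nu> * (2 * \<bar>b\<bar>) \<le> \<nu> * (\<bar>a + b\<bar> + \<bar>a - b\<bar>)" using \<nu> by (auto intro!: mult_left_mono)
    then have "\<nu> * \<bar>a\<bar> \<le> cmod y" "\<nu> * \<bar>b\<bar> \<le> cmod y"
      using 1 2 by (simp_all add: distrib_left)
    then show "\<nu> * ((cmod P)\<^sup>2 * e) \<le> cmod (profile_den \<sigma> N lam c k P Q)"
      "\<nu> * (\<bar>d\<bar> * (cmod Q)\<^sup>2) \<le> cmod (profile_den \<sigma> N lam c k P Q)"
      using e by (simp_all add: a_def b_def y_def abs_mult)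
  qed
  show thesis
  proof (rule that[of "\<nu> * min e \<bar>d\<bar>"])
    show "\<nu> * min e \<bar>d\<bar> > 0" using \<nu> e d by simp
    fix P Q
    have "\<nu> * min e \<bar>d\<bar> * (cmod P)\<^sup>2 \<le> \<nu> * ((cmod P)\<^sup>2 * e)"
      using \<nu> by (simp add: mult.assoc mult.commute[of _ e] mult_right_mono)
    with main(1)[of P Q] show "\<nu> * min e \<bar>d\<bar> * (cmod P)\<^sup>2 \<le> cmod (profile_den \<sigma> N lam c k P Q)"
      by simp
    have "\<nu> * min e \<bar>d\<bar> * (cmod Q)\<^sup>2 \<le> \<nu> * (\<bar>d\<bar> * (cmod Q)\<^sup>2)"
      using \<nu> by (simp add: mult.assoc mult_right_mono)
    with main(2)[where P = P and Q = Q]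
    show "\<nu> * min e \<bar>d\<bar> * (cmod Q)\<^sup>2 \<le> cmod (profile_den \<sigma> N lam c k P Q)"
      by simp
  qed
qed

text \<open>Once the larger of the two arguments has modulus 1, the denominator is bounded below;
  the product on the right makes a profile exponentially small away from its soliton.\<close>

lemma profile_bound:
  assumes "k \<in> {1..N}" "det (C_low \<sigma> lam c (k - 1)) \<noteq> 0" "det (C_low \<sigma> lam c k) \<noteq> 0"
  obtains K where "K \<ge> 0"
    and "\<And>P Q. cmod P = 1 \<or> cmod Q = 1 \<Longrightarrow> cmod (profile \<sigma> N lam c s k P Q) \<le> K * (cmod P * cmod Q)"
proof -
  obtain \<mu> where \<mu>: "\<mu> > 0"
    "\<And>P Q. \<mu> * (cmod P)\<^sup>2 \<le> cmod (profile_den \<sigma> N lam c k P Q)"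
    "\<And>P Q. \<mu> * (cmod Q)\<^sup>2 \<le> cmod (profile_den \<sigma> N lam c k P Q)"
    by (rule profile_den_bound[OF assms]) blast
  define A where "A = cmod (chat_minus \<sigma> N lam c s k * zratio lam k * cnj (shift_factor N lam k))"
  show thesis
  proof (rule that[of "A / \<mu>"])
    show "A / \<mu> \<ge> 0" using \<mu>(1) by (simp add: A_def)
    fix P Q :: complex
    assume "cmod P = 1 \<or> cmod Q = 1"
    then have "\<mu> \<le> cmod (profile_den \<sigma> N lam c k P Q)"
      using \<mu>(2)[where P = P and Q = Q] \<mu>(3)[where P = P and Q = Q] by auto
    then have "A * (cmod P * cmod Q) / cmod (profile_den \<sigma> N lam c k P Q) \<le> A * (cmod P * cmod Q) / \<mu>"
      using \<mu>(1) by (intro frac_le) (auto simp: A_def)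
    then show "cmod (profile \<sigma> N lam c s k P Q) \<le> A / \<mu> * (cmod P * cmod Q)"
      by (simp add: profile_def A_def norm_mult norm_divide mult_ac)
  qed
qed

section \<open>Stability of the determinant quotient near its limit\<close>

text \<open>Both determinants are Lipschitz on bounded sets and the limit denominator is bounded
  below, so their quotient moves by \<open>O(W)\<close>. The constants depend neither on
  \<open>p\<close> and \<open>q\<close> nor on \<open>W\<close>, which yields uniformity in
  \<open>x\<close> and \<open>t\<close>.\<close>

lemma num_den_near_limit:
  assumes "k \<in> {1..N}" "det (C_low \<sigma> lam c (k - 1)) \<noteq> 0" "det (C_low \<sigma> lam c k) \<noteq> 0"
  obtains K \<epsilon> where "\<epsilon> > 0" "K \<ge> 0"
    and "\<And>p q W. \<lbrakk>0 \<le> W; W \<le> \<epsilon>; \<And>j. cmod (p j) \<le> 1; \<And>j. cmod (q j) \<le> 1;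
        cmod (p k) = 1 \<or> cmod (q k) = 1;
        \<And>j. j \<in> {1..N} \<Longrightarrow> cmod (p j - p_lim k (p k) j) \<le> W;
        \<And>j. j \<in> {1..N} \<Longrightarrow> cmod (q j - q_lim k (q k) j) \<le> W\<rbrakk>
      \<Longrightarrow> cmod (- 2 * soliton_num \<sigma> N lam c s p q / soliton_den \<sigma> N lam c p q
          - profile \<sigma> N lam c s k (p k) (q k)) \<le> K * W"
proof -
  obtain \<mu> where \<mu>: "\<mu> > 0"
    "\<And>P Q. \<mu> * (cmod P)\<^sup>2 \<le> cmod (profile_den \<sigma> N lam c k P Q)"
    "\<And>P Q. \<mu> * (cmod Q)\<^sup>2 \<le> cmod (profile_den \<sigma> N lam c k P Q)"
    by (rule profile_den_bound[OF assms]) blast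
  obtain K3 where K3: "K3 \<ge> 0"
    "\<And>P Q. cmod P = 1 \<or> cmod Q = 1 \<Longrightarrow> cmod (profile \<sigma> N lam c s k P Q) \<le> K3 * (cmod P * cmod Q)"
    by (rule profile_bound[OF assms]) blast
  define C0 where "C0 = 2 / zratio lam k * lam_prod (k - 1) * det (C_low \<sigma> lam c (k - 1)) * det_grow_up N lam (Suc k)"
  have "k - 1 \<le> N" "Suc k \<in> {1..Suc N}" using assms(1) by auto
  then have "C0 \<noteq> 0"
    using assms(2) zratio_nz[OF assms(1)] lam_prod_nz[of "k - 1"] det_grow_up_nz[of "Suc k"]
    by (simp add: C0_def)
  define m0 where "m0 = cmod C0 * \<mu>"
  have m0: "m0 > 0" using \<open>C0 \<noteq> 0\<close> \<mu>(1) by (simp add: m0_def)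
  \<comment> \<open>A bound for all entries of both matrices when \<open>p\<close> and
    \<open>q\<close> are bounded by 1; the summand 1 covers the border column and keeps
    \<open>B\<close> positive.\<close>
  define B where "B = 1 + (\<Sum>i\<in>{1..N}. \<Sum>j\<in>{1..N}. cmod (E i j) + cmod (F i j)) + (\<Sum>j\<in>{1..N}. cmod (c j s))"
  have sums_nonneg: "(\<Sum>i\<in>{1..N}. \<Sum>j\<in>{1..N}. cmod (E i j) + cmod (F i j)) \<ge> 0"
    "(\<Sum>j\<in>{1..N}. cmod (c j s)) \<ge> 0" by (auto intro!: sum_nonneg)
  then have B1: "B \<ge> 1" by (simp add: B_def)
  have EF: "cmod (E i j) + cmod (F i j) \<le> B" if "i \<in> {1..N}" "j \<in> {1..N}" for i j
  proof -
    have "cmod (E i j) + cmod (F i j) \<le> (\<Sum>j\<in>{1..N}. cmod (E i j) + cmod (F i j))"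
      by (rule member_le_sum) (use that in auto)
    also have "\<dots> \<le> (\<Sum>i\<in>{1..N}. \<Sum>j\<in>{1..N}. cmod (E i j) + cmod (F i j))"
      by (rule member_le_sum) (use that in \<open>auto intro!: sum_nonneg\<close>)
    finally show ?thesis using sums_nonneg by (simp add: B_def)
  qed
  have cB: "cmod (c j s) \<le> B" if "j \<in> {1..N}" for j
  proof -
    have "cmod (c j s) \<le> (\<Sum>j\<in>{1..N}. cmod (c j s))"
      by (rule member_le_sum) (use that in auto)
    then show ?thesis using sums_nonneg by (simp add: B_def)
  qed
  define K1 where "K1 = fact (Suc N) * B ^ Suc N * real (Suc N) / B * (2 * B)"
  define K2 where "K2 = fact N * B ^ N * real N / B * (2 * B)"
  have K12: "K1 \<ge> 0" "K2 \<ge> 0" using B1 by (auto simp: K1_def K2_def)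
  show thesis
  \<comment> \<open>For \<open>W\<close> below the first value the denominator differs from its
    limit by at most \<open>m0 / 2\<close>, hence keeps modulus at least \<open>m0 / 2\<close>.
    Adding 1 to \<open>K2\<close> makes the divisor positive.\<close>
  proof (rule that[of "m0 / (2 * (K2 + 1))" "(2 * K1 + K3 * K2) / (m0 / 2)"])
    show "m0 / (2 * (K2 + 1)) > 0" "(2 * K1 + K3 * K2) / (m0 / 2) \<ge> 0"
      using m0 K12 K3(1) by auto
    fix p q :: "nat \<Rightarrow> complex" and W :: real
    assume W: "0 \<le> W" "W \<le> m0 / (2 * (K2 + 1))"
      and p1: "\<And>j. cmod (p j) \<le> 1" and q1: "\<And>j. cmod (q j) \<le> 1"
      and k1: "cmod (p k) = 1 \<or> cmod (q k) = 1"
      and pW: "\<And>j. j \<in> {1..N} \<Longrightarrow> cmod (p j - p_lim k (p k) j) \<le> W"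
      and qW: "\<And>j. j \<in> {1..N} \<Longrightarrow> cmod (q j - q_lim k (q k) j) \<le> W"
    define p' q' where "p' = p_lim k (p k)" and "q' = q_lim k (q k)"
    have p'1: "cmod (p' j) \<le> 1" and q'1: "cmod (q' j) \<le> 1" for j
      using p1[of k] q1[of k] by (auto simp: p'_def q'_def p_lim_def q_lim_def)
    have pW': "cmod (p j - p' j) \<le> W" and qW': "cmod (q j - q' j) \<le> W" if "j \<in> {1..N}" for j
      using pW[OF that] qW[OF that] by (auto simp: p'_def q'_def)
    have prod1: "cmod (cnj a * b) \<le> 1" if "cmod a \<le> 1" "cmod b \<le> 1" for a b
      using mult_mono[OF that] by (simp add: norm_mult)
    have prodW: "cmod (cnj a * b - cnj a' * b') \<le> 2 * W"
      if "cmod a \<le> 1" "cmod b' \<le> 1" "cmod (a - a') \<le> W" "cmod (b - b') \<le> W" for a b a' b'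
    proof -
      have "cnj a * b - cnj a' * b' = cnj a * (b - b') + cnj (a - a') * b'"
        by (simp add: algebra_simps)
      also have "cmod \<dots> \<le> cmod a * cmod (b - b') + cmod (a - a') * cmod b'"
        using norm_triangle_ineq[of "cnj a * (b - b')" "cnj (a - a') * b'"]
        by (simp only: norm_mult complex_mod_cnj)
      also have "\<dots> \<le> 1 * W + W * 1" using that W by (intro add_mono mult_mono) auto
      finally show ?thesis by simp
    qed
    have comb: "cmod (x * a + y * b) \<le> B * r"
      if "cmod x + cmod y \<le> B" "cmod a \<le> r" "cmod b \<le> r" "r \<ge> 0" for x y a b r
    proof -
      have "cmod (x * a + y * b) \<le> cmod x * r + cmod y * r"
        by (rule order_trans[OF norm_triangle_ineq])
          (use that in \<open>auto simp: norm_mult intro!: add_mono mult_left_mono\<close>)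
      also have "\<dots> \<le> B * r"
        using that by (simp add: mult_right_mono flip: distrib_right)
      finally show ?thesis .
    qed
    have entry: "cmod (pq_entry \<sigma> lam c f g i j) \<le> B"
      if "\<And>j. cmod (f j) \<le> 1" "\<And>j. cmod (g j) \<le> 1" "i \<in> {1..N}" "j \<in> {1..N}" for f g i j
      unfolding pq_entry_def using comb[of "E i j" "F i j" _ 1] EF prod1 that by simp
    have entry_diff: "cmod (pq_entry \<sigma> lam c p q i j - pq_entry \<sigma> lam c p' q' i j) \<le> 2 * B * W"
      if "i \<in> {1..N}" "j \<in> {1..N}" for i j
    proof -
      have "pq_entry \<sigma> lam c p q i j - pq_entry \<sigma> lam c p' q' i j
          = E i j * (cnj (p i) * p j - cnj (p' i) * p' j) + F i j * (cnj (q i) * q j - cnj (q' i) * q' j)"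
        by (simp add: pq_entry_def algebra_simps)
      also have "cmod \<dots> \<le> B * (2 * W)"
        by (rule comb) (use EF prodW p1 q1 p'1 q'1 pW' qW' that W in auto)
      finally show ?thesis by simp
    qed
    have bordered: "cmod (pq_bordered \<sigma> N lam c s f g i j) \<le> B"
      if "\<And>j. cmod (f j) \<le> 1" "\<And>j. cmod (g j) \<le> 1" "i < Suc N" "j < Suc N" for f g i j
    proof -
      have "cmod (c (Suc j) s) * cmod (g (Suc j)) \<le> B * 1" if "j < N"
        using cB[of "Suc j"] that \<open>\<And>j. cmod (g j) \<le> 1\<close> B1 by (intro mult_mono) auto
      moreover have "cmod (f (Suc i)) \<le> B" using that(1)[of "Suc i"] B1 by simp
      ultimately show ?thesis
        using entry[of f g "Suc i" "Suc j"] that B1 by (auto simp: pq_bordered_def norm_mult)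
    qed
    have BW: "W \<le> 2 * B * W" "B * W \<le> 2 * B * W"
      using mult_right_mono[OF B1 W(1)] W(1) B1 by auto
    have bordered_diff: "cmod (pq_bordered \<sigma> N lam c s p q i j - pq_bordered \<sigma> N lam c s p' q' i j) \<le> 2 * B * W"
      if "i < Suc N" "j < Suc N" for i j
    proof -
      have "cmod (c (Suc j) s * q (Suc j) - c (Suc j) s * q' (Suc j)) \<le> 2 * B * W" if "j < N"
      proof -
        have "cmod (c (Suc j) s * q (Suc j) - c (Suc j) s * q' (Suc j))
            = cmod (c (Suc j) s) * cmod (q (Suc j) - q' (Suc j))"
          by (simp flip: norm_mult right_diff_distrib)
        also have "\<dots> \<le> B * W"
          using cB[of "Suc j"] qW'[of "Suc j"] that B1 by (intro mult_mono) auto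
        finally show ?thesis using BW by simp
      qed
      moreover have "cmod (cnj (p (Suc i)) - cnj (p' (Suc i))) \<le> 2 * B * W" if "i < N"
        using pW'[of "Suc i"] BW that by (simp flip: complex_cnj_diff)
      ultimately show ?thesis
        using entry_diff[of "Suc i" "Suc j"] that B1 W by (auto simp: pq_bordered_def)
    qed
    define n d n0 d0 where "n = soliton_num \<sigma> N lam c s p q" and "d = soliton_den \<sigma> N lam c p q"
      and "n0 = soliton_num \<sigma> N lam c s p' q'" and "d0 = soliton_den \<sigma> N lam c p' q'"
    define v where "v = profile \<sigma> N lam c s k (p k) (q k)"
    have "cmod (n - n0) \<le> fact (Suc N) * B ^ Suc N * real (Suc N) / B * (2 * B * W)"
      unfolding n_def n0_def soliton_num_def
      by (rule norm_fdet_diff_le) (use B1 bordered bordered_diff p1 q1 p'1 q'1 in auto)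
    then have nn: "cmod (n - n0) \<le> K1 * W" by (simp only: K1_def mult.assoc)
    have "cmod (d - d0) \<le> fact N * B ^ N * real N / B * (2 * B * W)"
      unfolding d_def d0_def soliton_den_def
      by (rule norm_fdet_diff_le) (use B1 entry entry_diff p1 q1 p'1 q'1 in auto)
    then have dd: "cmod (d - d0) \<le> K2 * W" by (simp only: K2_def mult.assoc)
    have "\<mu> \<le> cmod (profile_den \<sigma> N lam c k (p k) (q k))"
      using k1 \<mu>(2)[where P = "p k" and Q = "q k"] \<mu>(3)[where P = "p k" and Q = "q k"] by auto
    then have d0: "m0 \<le> cmod d0"
      unfolding d0_def p'_def q'_def soliton_den_limit_profile[OF assms(1,2)] C0_def[symmetric] norm_mult m0_def
      by (intro mult_left_mono) auto
    have "K2 * W \<le> (K2 + 1) * (m0 / (2 * (K2 + 1)))"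
      using W K12 by (intro mult_mono) auto
    also have "\<dots> = m0 / 2" using K12 by (simp add: field_simps)
    finally have "cmod (d - d0) \<le> m0 / 2" using dd by simp
    then have d: "m0 / 2 \<le> cmod d"
      using d0 norm_triangle_ineq2[of d0 "d0 - d"] by (simp add: norm_minus_commute)
    have dnz: "d \<noteq> 0" "d0 \<noteq> 0" using d d0 m0 by auto
    have v: "v = - 2 * n0 / d0"
      unfolding v_def n0_def d0_def p'_def q'_def by (rule profile_eq_limit[OF assms(1,2)])
    have "cmod (p k) * cmod (q k) \<le> 1" using mult_mono[OF p1[of k] q1[of k]] by simp
    then have "cmod v \<le> K3 * 1"
      unfolding v_def using K3(2)[of "p k" "q k"] k1 K3(1) by (meson mult_left_mono order_trans)
    then have v3: "cmod v * cmod (d - d0) \<le> K3 * (K2 * W)"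
      using dd K3(1) by (intro mult_mono) auto
    \<comment> \<open>Writing the limit as \<open>v\<close> avoids a product of denominators: the
      error is linear in \<open>n - n0\<close> and \<open>d - d0\<close>, and only \<open>d\<close>
      has to be bounded below.\<close>
    have "v * d0 = - 2 * n0" using v dnz by simp
    then have "- 2 * n / d - v = - (2 * (n - n0) + v * (d - d0)) / d"
      using dnz by (simp add: field_simps)
    then have "cmod (- 2 * n / d - v) = cmod (2 * (n - n0) + v * (d - d0)) / cmod d"
      by (simp add: norm_divide norm_minus_cancel del: minus_add_distrib)
    also have "\<dots> \<le> (2 * (K1 * W) + K3 * (K2 * W)) / (m0 / 2)"
    proof (rule frac_le)
      show "cmod (2 * (n - n0) + v * (d - d0)) \<le> 2 * (K1 * W) + K3 * (K2 * W)"
        using norm_triangle_ineq[of "2 * (n - n0)" "v * (d - d0)"] nn v3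
        unfolding norm_mult norm_numeral by linarith
    qed (use m0 d K12 K3(1) W in auto)
    also have "\<dots> = (2 * K1 + K3 * K2) / (m0 / 2) * W" by (simp add: field_simps)
    finally show "cmod (- 2 * soliton_num \<sigma> N lam c s p q / soliton_den \<sigma> N lam c p q
        - profile \<sigma> N lam c s k (p k) (q k)) \<le> (2 * K1 + K3 * K2) / (m0 / 2) * W"
      by (simp add: n_def d_def v_def)
  qed
qed

text \<open>
  \<open>C Z - Z\<^sup>* C = - G\<^sup>* G\<close>, where \<open>Z = diag(z\<^sub>i)\<close> and \<open>G\<close> has columns \<open>c\<^sub>i\<close>.  As \<open>C\<close> is skew-Hermitian,
  \<open>G\<close> vanishes on the kernel of \<open>C\<close>, which is therefore invariant under \<open>Z\<close>.  Since the
  \<open>z\<^sub>i\<close> are distinct, a kernel vector of minimal support would be a multiple of a unit vector,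
  on which \<open>G\<close> does not vanish.
\<close>

lemma det_C_low_nz:
  assumes "\<sigma> = 1" "m \<le> N" and c_nz: "\<And>i. i \<in> {1..N} \<Longrightarrow> c i 1 \<noteq> 0 \<or> c i 2 \<noteq> 0"
  shows "det (C_low \<sigma> lam c m) \<noteq> 0"
proof
  assume det0: "det (C_low \<sigma> lam c m) = 0"
  define h where "h = (\<lambda>i j. cauchy_entry \<sigma> lam c (Suc i) (Suc j))"
  define y where "y = (\<lambda>j. z (Suc j))"
  define g where "g = (\<lambda>s j. cvec lam c (Suc j) s)"
  have C: "C_low \<sigma> lam c m = mat m m (\<lambda>(i, j). h i j)" by (simp add: C_low_def h_def)
  have lyap: "h i j * (y j - cnj (y i)) = - (cnj (g 1 i) * g 1 j + cnj (g 2 i) * g 2 j)"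
    if "i < m" "j < m" for i j
    using z_minus_cnj[of "Suc i" "Suc j"] that assms(1,2)
    by (simp add: h_def y_def g_def cauchy_entry_def Lambda_diag_def)
  have cnj_h: "cnj (h i j) = - h j i" for i j by (simp add: h_def cauchy_entry_cnj)
  define ker where "ker = (\<lambda>f. \<forall>i<m. (\<Sum>j<m. h i j * f j) = 0)"
  have annihilates: "(\<Sum>j<m. g 1 j * f j) = 0 \<and> (\<Sum>j<m. g 2 j * f j) = 0" if "ker f" for f
  proof -
    define w where "w = (\<lambda>s. \<Sum>j<m. g s j * f j)"
    have cw: "cnj (w s) = (\<Sum>i<m. cnj (f i) * cnj (g s i))" for s
      by (simp add: w_def mult.commute)
    have "(\<Sum>i<m. \<Sum>j<m. cnj (f i) * (h i j * (y j - cnj (y i))) * f j)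
        = (\<Sum>i<m. \<Sum>j<m. - (cnj (f i) * cnj (g 1 i) * (g 1 j * f j))
                          - cnj (f i) * cnj (g 2 i) * (g 2 j * f j))"
      by (intro sum.cong refl, subst lyap) (auto simp: algebra_simps)
    also have "\<dots> = - (cnj (w 1) * w 1) - cnj (w 2) * w 2"
      unfolding cw unfolding w_def sum_product by (simp only: sum_subtractf sum_negf)
    finally have 1: "(\<Sum>i<m. \<Sum>j<m. cnj (f i) * (h i j * (y j - cnj (y i))) * f j)
        = - (cnj (w 1) * w 1) - cnj (w 2) * w 2" .
    \<comment> \<open>The same quadratic form vanishes: by skew symmetry \<open>f\<close> also
      annihilates the matrix from the left, which removes the first sum, and \<open>ker f\<close>
      removes the second.\<close>
    have "(\<Sum>i<m. \<Sum>j<m. cnj (f i) * (h i j * (y j - cnj (y i))) * f j)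
        = (\<Sum>i<m. \<Sum>j<m. (cnj (f i) * h i j) * (y j * f j))
          - (\<Sum>i<m. \<Sum>j<m. (cnj (f i) * cnj (y i)) * (h i j * f j))"
      unfolding sum_subtractf[symmetric] by (intro sum.cong refl) (simp add: algebra_simps)
    also have "(\<Sum>i<m. \<Sum>j<m. (cnj (f i) * h i j) * (y j * f j))
        = (\<Sum>j<m. (\<Sum>i<m. cnj (f i) * h i j) * (y j * f j))"
      by (subst sum.swap) (simp add: sum_distrib_right)
    also have "\<dots> = 0"
    proof (rule sum.neutral, rule ballI)
      fix j assume "j \<in> {..<m}"
      then have "cnj (\<Sum>i<m. h j i * f i) = 0" using \<open>ker f\<close> by (simp add: ker_def)
      then have "(\<Sum>i<m. cnj (f i) * h i j) = 0"
        by (simp add: cnj_h sum_negf mult.commute)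
      then show "(\<Sum>i<m. cnj (f i) * h i j) * (y j * f j) = 0" by simp
    qed
    also have "(\<Sum>i<m. \<Sum>j<m. (cnj (f i) * cnj (y i)) * (h i j * f j)) = 0"
      using \<open>ker f\<close> by (simp add: ker_def flip: sum_distrib_left)
    finally have "cnj (w 1) * w 1 + cnj (w 2) * w 2 = 0" using 1 by (simp add: algebra_simps)
    then have "of_real ((cmod (w 1))\<^sup>2 + (cmod (w 2))\<^sup>2) = (0 :: complex)"
      unfolding of_real_add complex_norm_square by (simp add: mult.commute)
    then have "(cmod (w 1))\<^sup>2 + (cmod (w 2))\<^sup>2 = 0" by (simp only: of_real_eq_0_iff)
    then have "w 1 = 0 \<and> w 2 = 0" by (simp add: add_nonneg_eq_0_iff)
    then show ?thesis unfolding w_def .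
  qed
  have ker_mult: "ker (\<lambda>j. (y j - a) * f j)" if "ker f" for f a
    unfolding ker_def
  proof (intro allI impI)
    fix i assume i: "i < m"
    have "(\<Sum>j<m. h i j * ((y j - a) * f j))
        = (\<Sum>j<m. (cnj (y i) - a) * (h i j * f j) - cnj (g 1 i) * (g 1 j * f j) - cnj (g 2 i) * (g 2 j * f j))"
    proof (rule sum.cong[OF refl])
      fix j assume "j \<in> {..<m}"
      then have j: "j < m" by simp
      have eq: "h i j * ((y j - a) * f j)
          = (h i j * (y j - cnj (y i))) * f j + (cnj (y i) - a) * (h i j * f j)"
        by (simp add: algebra_simps)
      show "h i j * ((y j - a) * f j) = (cnj (y i) - a) * (h i j * f j)
          - cnj (g 1 i) * (g 1 j * f j) - cnj (g 2 i) * (g 2 j * f j)"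
        unfolding eq lyap[OF i j] by (simp add: algebra_simps)
    qed
    also have "\<dots> = 0"
      unfolding sum_subtractf sum_distrib_left[symmetric]
      using annihilates[OF that] that i by (simp add: ker_def)
    finally show "(\<Sum>j<m. h i j * ((y j - a) * f j)) = 0" .
  qed
  define Z where "Z = {f. ker f \<and> (\<exists>j<m. f j \<noteq> 0)}"
  obtain v where v: "v \<in> carrier_vec m" "v \<noteq> 0\<^sub>v m" "mat m m (\<lambda>(i, j). h i j) *\<^sub>v v = 0\<^sub>v m"
    using det0 unfolding C by (subst (asm) det_0_iff_vec_prod_zero[where n = m]) auto
  have "(\<Sum>j<m. h i j * v $ j) = 0" if "i < m" for i
    using arg_cong[OF v(3), of "\<lambda>u. u $ i"] v(1) that
    by (simp add: scalar_prod_def atLeast0LessThan)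
  moreover have "\<exists>j<m. v $ j \<noteq> 0" using v(1,2) by (metis carrier_vecD eq_vecI index_zero_vec)
  ultimately have "(\<lambda>j. v $ j) \<in> Z" by (simp add: Z_def ker_def)
  then obtain f where f: "f \<in> Z"
    and least: "\<And>f'. f' \<in> Z \<Longrightarrow> card {j. j < m \<and> f j \<noteq> 0} \<le> card {j. j < m \<and> f' j \<noteq> 0}"
    using ex_has_least_nat[of "\<lambda>f. f \<in> Z" _ "\<lambda>f. card {j. j < m \<and> f j \<noteq> 0}"] by blast
  obtain i where i: "i < m" "f i \<noteq> 0" using f by (auto simp: Z_def)
  \<comment> \<open>The factor removes index \<open>i\<close> from the support, so minimality forces
    \<open>f'\<close> to vanish; as the \<open>y j\<close> are distinct, \<open>f\<close> is
    supported at \<open>i\<close> alone.\<close>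
  define f' where "f' = (\<lambda>j. (y j - y i) * f j)"
  have "card {j. j < m \<and> f' j \<noteq> 0} < card {j. j < m \<and> f j \<noteq> 0}"
    by (rule psubset_card_mono) (use i in \<open>auto simp: f'_def\<close>)
  then have "f' \<notin> Z" using least[of f'] by auto
  moreover have "ker f'" unfolding f'_def by (rule ker_mult) (use f in \<open>simp add: Z_def\<close>)
  ultimately have f'0: "f' j = 0" if "j < m" for j using that by (auto simp: Z_def)
  have only_i: "f j = 0" if "j < m" "j \<noteq> i" for j
    using f'0[OF that(1)] z_minus_z[of "Suc i" "Suc j"] that i assms(2) by (auto simp: f'_def y_def)
  have sum_i: "(\<Sum>j<m. g s j * f j) = g s i * f i" for s
    using i by (subst sum.remove[of _ i]) (auto simp: only_i intro!: sum.neutral)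
  have "g 1 i = 0 \<and> g 2 i = 0"
    using annihilates[of f] f i unfolding sum_i by (auto simp: Z_def)
  then show False
    using c_nz[of "Suc i"] z_nz[of "Suc i"] i assms(2) by (auto simp: g_def cvec_def)
qed

section \<open>Sectors around the solitons and estimates uniform in \<open>x\<close>\<close>

text \<open>The smallness \<open>W\<close> is a parameter rather than an exponential in
  \<open>t\<close>: for \<open>N = 1\<close> the condition is vacuous and \<open>W = 0\<close> is
  allowed.\<close>

definition in_sector :: "nat \<Rightarrow> real \<Rightarrow> real \<Rightarrow> real \<Rightarrow> bool" where
  "in_sector k W x t \<longleftrightarrow> (\<forall>j\<in>{1..N}. j \<noteq> k \<longrightarrow> exp (- 2 * \<bar>Re (theta lam j x t)\<bar>) \<le> W
     \<and> (if j < k then Re (theta lam j x t) \<le> 0 else Re (theta lam j x t) \<ge> 0))"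

lemma asymptotics_in_sector:
  assumes dets: "\<And>k. k \<in> {1..N} \<Longrightarrow> det (C_low \<sigma> lam c k) \<noteq> 0" and k: "k \<in> {1..N}"
  obtains K \<epsilon> where "\<epsilon> > 0" "K \<ge> 0"
    and "\<And>x t W. 0 \<le> W \<Longrightarrow> W \<le> \<epsilon> \<Longrightarrow> in_sector k W x t \<Longrightarrow>
      cmod (u_soliton \<sigma> N lam c s x t - (\<Sum>k=1..N. u_minus \<sigma> N lam c s k x t)) \<le> K * W"
proof -
  have dets': "det (C_low \<sigma> lam c (k - 1)) \<noteq> 0" if "k \<in> {1..N}" for k
  proof (cases "k = 1")
    case True
    then show ?thesis by (simp add: C_low_def)
  next
    case False
    then show ?thesis using that by (intro dets) auto
  qed
  obtain K \<epsilon> where K: "\<epsilon> > 0" "K \<ge> 0"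
    "\<And>p q W. \<lbrakk>0 \<le> W; W \<le> \<epsilon>; \<And>j. cmod (p j) \<le> 1; \<And>j. cmod (q j) \<le> 1;
        cmod (p k) = 1 \<or> cmod (q k) = 1;
        \<And>j. j \<in> {1..N} \<Longrightarrow> cmod (p j - p_lim k (p k) j) \<le> W;
        \<And>j. j \<in> {1..N} \<Longrightarrow> cmod (q j - q_lim k (q k) j) \<le> W\<rbrakk>
      \<Longrightarrow> cmod (- 2 * soliton_num \<sigma> N lam c s p q / soliton_den \<sigma> N lam c p q
          - profile \<sigma> N lam c s k (p k) (q k)) \<le> K * W"
    using num_den_near_limit[OF k dets'[OF k] dets[OF k]] by metis
  have "\<forall>j\<in>{1..N}. \<exists>L\<ge>0. \<forall>P Q. cmod P = 1 \<or> cmod Q = 1 \<longrightarrow>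
      cmod (profile \<sigma> N lam c s j P Q) \<le> L * (cmod P * cmod Q)"
    using profile_bound dets dets' by metis
  then obtain L where L: "\<And>j. j \<in> {1..N} \<Longrightarrow> L j \<ge> 0"
    "\<And>j P Q. j \<in> {1..N} \<Longrightarrow> cmod P = 1 \<or> cmod Q = 1 \<Longrightarrow>
      cmod (profile \<sigma> N lam c s j P Q) \<le> L j * (cmod P * cmod Q)"
    by metis
  show thesis
  proof (rule that[of \<epsilon> "K + (\<Sum>j\<in>{1..N}. L j)"])
    show "\<epsilon> > 0" "K + (\<Sum>j\<in>{1..N}. L j) \<ge> 0" using K L(1) by (auto intro!: add_nonneg_nonneg sum_nonneg)
    fix x t W :: real
    assume W: "0 \<le> W" "W \<le> \<epsilon>" and sector: "in_sector k W x t"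
    define \<theta> where "\<theta> = (\<lambda>j. theta lam j x t)"
    define R where "R = (\<lambda>j. \<bar>Re (\<theta> j)\<bar>)"
    \<comment> \<open>The factors make \<open>q j = 1\<close> for \<open>j < k\<close>,
      \<open>p j = 1\<close> for \<open>j > k\<close>, and the larger of the moduli of
      \<open>p k\<close> and \<open>q k\<close> equal to 1. Indices outside \<open>{1..N}\<close>
      are treated like \<open>k\<close> because the bounds on \<open>p\<close> and \<open>q\<close>
      are required for every index.\<close>
    define r where "r = (\<lambda>j. if j = k \<or> j \<notin> {1..N} then of_real (exp (- R j))
        else if j < k then exp (\<theta> j) else exp (- \<theta> j))"
    define p q where "p = (\<lambda>j. r j * exp (\<theta> j))" and "q = (\<lambda>j. r j * exp (- \<theta> j))"
    have sec: "exp (- 2 * R j) \<le> W" "if j < k then Re (\<theta> j) \<le> 0 else Re (\<theta> j) \<ge> 0"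
      if "j \<in> {1..N}" "j \<noteq> k" for j
      using sector that by (auto simp: in_sector_def R_def \<theta>_def)
    have u: "u_soliton \<sigma> N lam c s x t = - 2 * soliton_num \<sigma> N lam c s p q / soliton_den \<sigma> N lam c p q"
      by (rule u_soliton_eq_num_den[of r]) (auto simp: r_def p_def q_def \<theta>_def)
    have norm_p: "cmod (p j) = exp (Re (\<theta> j) - R j)" and norm_q: "cmod (q j) = exp (- Re (\<theta> j) - R j)"
      if "j = k \<or> j \<notin> {1..N}" for j
      using that by (auto simp: p_def q_def r_def norm_mult algebra_simps simp flip: exp_add)
    have p_gt: "p j = 1" "q j = exp (- 2 * \<theta> j)" if "j \<in> {1..N}" "j > k" for j
      using that by (auto simp: p_def q_def r_def simp flip: exp_add)
    have p_lt: "p j = exp (2 * \<theta> j)" "q j = 1" if "j \<in> {1..N}" "j < k" for j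
      using that by (auto simp: p_def q_def r_def simp flip: exp_add)
    have small_q: "cmod (q j) = exp (- 2 * R j)" if "j \<in> {1..N}" "j > k" for j
      using p_gt[OF that] sec(2)[of j] that by (simp add: R_def)
    have small_p: "cmod (p j) = exp (- 2 * R j)" if "j \<in> {1..N}" "j < k" for j
      using p_lt[OF that] sec(2)[of j] that by (simp add: R_def)
    have le1: "cmod (p j) \<le> 1" "cmod (q j) \<le> 1" for j
    proof -
      consider "j = k \<or> j \<notin> {1..N}" | "j \<in> {1..N}" "j < k" | "j \<in> {1..N}" "j > k" by fastforce
      then have "cmod (p j) \<le> 1 \<and> cmod (q j) \<le> 1"
      proof cases
        case 1
        then show ?thesis unfolding norm_p[OF 1] norm_q[OF 1]
          using abs_ge_self[of "Re (\<theta> j)"] abs_ge_minus_self[of "Re (\<theta> j)"] by (simp add: R_def)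
      next
        case 2
        then show ?thesis using small_p[OF 2] p_lt[OF 2] by (simp add: R_def)
      next
        case 3
        then show ?thesis using small_q[OF 3] p_gt[OF 3] by (simp add: R_def)
      qed
      then show "cmod (p j) \<le> 1" "cmod (q j) \<le> 1" by auto
    qed
    have k1: "cmod (p k) = 1 \<or> cmod (q k) = 1"
      using norm_p[of k] norm_q[of k] by (auto simp: R_def abs_if)
    have main: "cmod (u_soliton \<sigma> N lam c s x t - profile \<sigma> N lam c s k (p k) (q k)) \<le> K * W"
      unfolding u
    proof (rule K(3)[where p = p and q = q and W = W, OF W le1 k1])
      fix j assume j: "j \<in> {1..N}"
      show "cmod (p j - p_lim k (p k) j) \<le> W"
        using small_p[OF j] p_gt[OF j] sec(1)[OF j] W by (cases j k rule: linorder_cases) (auto simp: p_lim_def)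
      show "cmod (q j - q_lim k (q k) j) \<le> W"
        using small_q[OF j] p_lt[OF j] sec(1)[OF j] W by (cases j k rule: linorder_cases) (auto simp: q_lim_def)
    qed
    have uk: "u_minus \<sigma> N lam c s k x t = profile \<sigma> N lam c s k (p k) (q k)"
      using u_minus_eq_profile[OF k, of "exp (- R k)"] by (simp add: p_def q_def r_def \<theta>_def)
    have others: "cmod (u_minus \<sigma> N lam c s j x t) \<le> L j * W" if j: "j \<in> {1..N}" "j \<noteq> k" for j
    proof -
      \<comment> \<open>The remaining profiles use their own normalization, with the larger modulus
        equal to 1, as \<open>profile_bound\<close> demands.\<close>
      define P Q where "P = of_real (exp (- R j)) * exp (\<theta> j)" and "Q = of_real (exp (- R j)) * exp (- \<theta> j)"
      have n: "cmod P = exp (Re (\<theta> j) - R j)" "cmod Q = exp (- Re (\<theta> j) - R j)"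
        by (auto simp: P_def Q_def norm_mult algebra_simps simp flip: exp_add)
      then have PQ1: "cmod P = 1 \<or> cmod Q = 1" by (auto simp: R_def abs_if)
      have PQ: "cmod P * cmod Q = exp (- 2 * R j)" unfolding n by (simp flip: exp_add)
      have "u_minus \<sigma> N lam c s j x t = profile \<sigma> N lam c s j P Q"
        using u_minus_eq_profile[OF j(1), of "exp (- R j)"] by (simp add: P_def Q_def \<theta>_def)
      then have "cmod (u_minus \<sigma> N lam c s j x t) \<le> L j * exp (- 2 * R j)"
        using L(2)[OF j(1) PQ1] PQ by simp
      also have "\<dots> \<le> L j * W" using sec(1)[OF j] L(1)[OF j(1)] by (rule mult_left_mono)
      finally show ?thesis .
    qed
    have "(\<Sum>k=1..N. u_minus \<sigma> N lam c s k x t)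
        = u_minus \<sigma> N lam c s k x t + (\<Sum>j\<in>{1..N} - {k}. u_minus \<sigma> N lam c s j x t)"
      using k by (intro sum.remove) auto
    then have "cmod (u_soliton \<sigma> N lam c s x t - (\<Sum>k=1..N. u_minus \<sigma> N lam c s k x t))
        = cmod ((u_soliton \<sigma> N lam c s x t - profile \<sigma> N lam c s k (p k) (q k))
            - (\<Sum>j\<in>{1..N} - {k}. u_minus \<sigma> N lam c s j x t))"
      by (simp add: uk algebra_simps)
    also have "\<dots> \<le> K * W + (\<Sum>j\<in>{1..N} - {k}. L j * W)"
      by (rule order_trans[OF norm_triangle_ineq4])
        (intro add_mono main sum_norm_le others; auto)
    also have "(\<Sum>j\<in>{1..N} - {k}. L j * W) \<le> (\<Sum>j\<in>{1..N}. L j * W)"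
      by (rule sum_mono2) (use L(1) W in auto)
    finally show "cmod (u_soliton \<sigma> N lam c s x t - (\<Sum>k=1..N. u_minus \<sigma> N lam c s k x t))
        \<le> (K + (\<Sum>j\<in>{1..N}. L j)) * W"
      by (simp add: distrib_right sum_distrib_right)
  qed
qed

text \<open>If soliton \<open>k\<close> is nearest to \<open>x\<close>, every other one is at least
  half the mutual distance away. This half cancels against the 2 in
  \<open>exp (- 2 * \<bar>Re \<theta>\<bar>)\<close>, which gives exactly the stated rate.\<close>

lemma nearest_in_sector:
  assumes k: "k \<in> {1..N}"
    and near: "\<And>j. j \<in> {1..N} \<Longrightarrow> \<bar>x - vel lam k * t\<bar> \<le> \<bar>x - vel lam j * t\<bar>"
    and order: "\<And>i j. i \<in> {1..N} \<Longrightarrow> j \<in> {1..N} \<Longrightarrow> i < j \<Longrightarrow> vel lam j * t < vel lam i * t"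
    and rate: "\<And>i j. i \<in> {1..N} \<Longrightarrow> j \<in> {1..N} \<Longrightarrow> i \<noteq> j \<Longrightarrow>
      d \<le> \<bar>Im (z i)\<bar> * \<bar>vel lam i - vel lam j\<bar>"
    and W: "N \<noteq> 1 \<Longrightarrow> W = exp (- d * \<bar>t\<bar>)"
  shows "in_sector k W x t"
  unfolding in_sector_def
proof (intro ballI impI)
  fix j assume j: "j \<in> {1..N}" "j \<noteq> k"
  define a b D where "a = x - vel lam j * t" and "b = x - vel lam k * t"
    and "D = \<bar>vel lam j - vel lam k\<bar> * \<bar>t\<bar>"
  have Re: "Re (theta lam j x t) = \<bar>Im (z j)\<bar> * a" using Re_theta[OF j(1)] by (simp add: a_def)
  have ab: "\<bar>b\<bar> \<le> \<bar>a\<bar>" unfolding a_def b_def by (rule near[OF j(1)])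
  have D: "D = \<bar>a - b\<bar>" by (simp add: a_def b_def D_def abs_mult[symmetric] algebra_simps)
  have lt: "a < b" if "j < k" using order[OF j(1) k that] by (simp add: a_def b_def)
  have gt: "b < a" if "k < j" using order[OF k j(1) that] by (simp add: a_def b_def)
  have "D \<le> 2 * \<bar>a\<bar>" using D ab by linarith
  have "d * \<bar>t\<bar> \<le> \<bar>Im (z j)\<bar> * D"
    using mult_right_mono[OF rate[OF j(1) k j(2)], of "\<bar>t\<bar>"] by (simp add: D_def mult_ac)
  also have "\<dots> \<le> \<bar>Im (z j)\<bar> * (2 * \<bar>a\<bar>)"
    using \<open>D \<le> 2 * \<bar>a\<bar>\<close> by (intro mult_left_mono) auto
  also have "\<dots> = 2 * \<bar>Re (theta lam j x t)\<bar>" by (simp add: Re abs_mult)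
  finally have "exp (- 2 * \<bar>Re (theta lam j x t)\<bar>) \<le> exp (- d * \<bar>t\<bar>)" by simp
  moreover have "N \<noteq> 1" using j k by auto
  \<comment> \<open>If \<open>a < b\<close> and \<open>a\<close> were positive, \<open>b\<close>
    would exceed \<open>a\<close> in modulus, against the choice of \<open>k\<close>; likewise in
    the other case.\<close>
  moreover have "if j < k then a \<le> 0 else a \<ge> 0"
    using ab lt gt j(2) by (cases j k rule: linorder_cases) auto
  ultimately show "exp (- 2 * \<bar>Re (theta lam j x t)\<bar>) \<le> W \<and>
      (if j < k then Re (theta lam j x t) \<le> 0 else 0 \<le> Re (theta lam j x t))"
    using W unfolding Re by (auto simp: mult_nonneg_nonpos split: if_splits)
qed

text \<open>The order is imposed on the positions \<open>vel lam j * t\<close> and not on the sign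
  of \<open>t\<close>. Thus the lemma serves \<open>t < 0\<close> with increasing velocities and
  \<open>t > 0\<close> with the reversed numbering.\<close>

lemma asymptotics:
  assumes "N \<ge> 1"
    and dets: "\<And>k. k \<in> {1..N} \<Longrightarrow> det (C_low \<sigma> lam c k) \<noteq> 0"
    and rate: "\<And>i j. i \<in> {1..N} \<Longrightarrow> j \<in> {1..N} \<Longrightarrow> i \<noteq> j \<Longrightarrow>
      d \<le> \<bar>Im (z i)\<bar> * \<bar>vel lam i - vel lam j\<bar>"
    and d_pos: "N \<noteq> 1 \<Longrightarrow> d > 0"
  shows "\<exists>K T. T > 0 \<and> (\<forall>x t. T \<le> \<bar>t\<bar> \<longrightarrow>
      (\<forall>i\<in>{1..N}. \<forall>j\<in>{1..N}. i < j \<longrightarrow> vel lam j * t < vel lam i * t) \<longrightarrow>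
      cmod (u_soliton \<sigma> N lam c s x t - (\<Sum>k=1..N. u_minus \<sigma> N lam c s k x t))
        \<le> K * exp (- d * \<bar>t\<bar>))"
proof -
  have "\<forall>k\<in>{1..N}. \<exists>K \<epsilon>. \<epsilon> > 0 \<and> K \<ge> 0 \<and> (\<forall>x t W. 0 \<le> W \<longrightarrow> W \<le> \<epsilon> \<longrightarrow> in_sector k W x t \<longrightarrow>
      cmod (u_soliton \<sigma> N lam c s x t - (\<Sum>k=1..N. u_minus \<sigma> N lam c s k x t)) \<le> K * W)"
    using asymptotics_in_sector[OF dets] by metis
  then obtain K \<epsilon> where K: "\<And>k. k \<in> {1..N} \<Longrightarrow> \<epsilon> k > 0" "\<And>k. k \<in> {1..N} \<Longrightarrow> K k \<ge> 0"
    "\<And>k x t W. k \<in> {1..N} \<Longrightarrow> 0 \<le> W \<Longrightarrow> W \<le> \<epsilon> k \<Longrightarrow> in_sector k W x t \<Longrightarrow>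
      cmod (u_soliton \<sigma> N lam c s x t - (\<Sum>k=1..N. u_minus \<sigma> N lam c s k x t)) \<le> K k * W"
    by metis
  define e where "e = Min (insert 1 (\<epsilon> ` {1..N}))"
  have e: "e > 0" using K(1) by (auto simp: e_def)
  have e_le: "e \<le> \<epsilon> k" if "k \<in> {1..N}" for k
    unfolding e_def by (rule Min_le) (use that in auto)
  define L where "L = (\<Sum>k\<in>{1..N}. K k)"
  have KL: "K k \<le> L" if "k \<in> {1..N}" for k
    unfolding L_def by (rule member_le_sum) (use that K(2) in auto)
  \<comment> \<open>From \<open>T\<close> on, \<open>exp (- d * \<bar>t\<bar>)\<close> is at most
    \<open>e\<close> if \<open>N \<noteq> 1\<close>; the maximum with 1 makes \<open>T\<close>
    positive in every case.\<close>
  define T where "T = max 1 (- ln e / d)"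
  show ?thesis
  proof (rule exI[of _ L], rule exI[of _ T], intro conjI allI impI)
    show "T > 0" by (simp add: T_def)
    fix x t :: real
    assume t: "T \<le> \<bar>t\<bar>"
      and "\<forall>i\<in>{1..N}. \<forall>j\<in>{1..N}. i < j \<longrightarrow> vel lam j * t < vel lam i * t"
    then have order: "vel lam j * t < vel lam i * t" if "i \<in> {1..N}" "j \<in> {1..N}" "i < j" for i j
      using that by blast
    \<comment> \<open>For \<open>N = 1\<close> nothing is known about \<open>d\<close>; with
      \<open>W = 0\<close> the difference is exactly 0, so any rate will do.\<close>
    define W where "W = (if N = 1 then 0 else exp (- d * \<bar>t\<bar>))"
    have "{1..N} \<noteq> {}" using assms(1) by auto
    then obtain k where k: "k \<in> {1..N}"
      "\<And>j. j \<in> {1..N} \<Longrightarrow> \<bar>x - vel lam k * t\<bar> \<le> \<bar>x - vel lam j * t\<bar>"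
      using ex_min_if_finite[of "(\<lambda>k. \<bar>x - vel lam k * t\<bar>) ` {1..N}"]
      by (force simp: not_less)
    have sector: "in_sector k W x t"
      by (rule nearest_in_sector[OF k order rate]) (auto simp: W_def)
    have "W \<le> e"
    proof (cases "N = 1")
      case True
      then show ?thesis using e by (simp add: W_def)
    next
      case False
      have "- ln e / d \<le> \<bar>t\<bar>" using t by (simp add: T_def)
      then have "- d * \<bar>t\<bar> \<le> ln e" using d_pos[OF False] by (simp add: field_simps)
      then show ?thesis using False e by (simp add: W_def ln_ge_iff)
    qed
    moreover have "0 \<le> W" "W \<le> exp (- d * \<bar>t\<bar>)" by (auto simp: W_def)
    ultimately have "cmod (u_soliton \<sigma> N lam c s x t - (\<Sum>k=1..N. u_minus \<sigma> N lam c s k x t)) \<le> K k * W"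
      using K(3)[OF k(1) _ _ sector] e_le[OF k(1)] by simp
    also have "\<dots> \<le> L * exp (- d * \<bar>t\<bar>)"
      using KL[OF k(1)] K(2)[OF k(1)] \<open>0 \<le> W\<close> \<open>W \<le> exp (- d * \<bar>t\<bar>)\<close> by (intro mult_mono) auto
    finally show "cmod (u_soliton \<sigma> N lam c s x t - (\<Sum>k=1..N. u_minus \<sigma> N lam c s k x t))
        \<le> L * exp (- d * \<bar>t\<bar>)" .
  qed
qed

end

section \<open>Reversing the order of the solitons\<close>

text \<open>The renumbering \<open>i \<mapsto> N + 1 - i\<close> exchanges lower with upper index
  ranges and thereby reduces \<open>u_plus\<close> to \<open>u_minus\<close>.\<close>

locale reversal =
  fixes N :: nat and lam lam' :: "nat \<Rightarrow> complex" and c c' :: "nat \<Rightarrow> nat \<Rightarrow> complex"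
  assumes lam': "lam' i = lam (Suc N - i)" and c': "c' i s = c (Suc N - i) s"
begin

lemma zpar_rev: "zpar lam' i = zpar lam (Suc N - i)"
  by (simp add: zpar_def lam')

lemma theta_rev: "theta lam' i x t = theta lam (Suc N - i) x t"
  by (simp add: theta_def zpar_rev)

lemma cauchy_entry_rev: "cauchy_entry \<sigma> lam' c' i j = cauchy_entry \<sigma> lam c (Suc N - i) (Suc N - j)"
  by (simp add: cauchy_entry_def cvec_def zpar_rev c')

lemma pq_entry_rev:
  "pq_entry \<sigma> lam' c' (\<lambda>j. p (Suc N - j)) (\<lambda>j. q (Suc N - j)) i j
    = pq_entry \<sigma> lam c p q (Suc N - i) (Suc N - j)"
  by (simp add: pq_entry_def grow_coef_def decay_coef_def cauchy_entry_rev zpar_rev lam')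

lemma u_soliton_rev: "u_soliton \<sigma> N lam' c' s x t = u_soliton \<sigma> N lam c s x t"
proof -
  define p q where "p = (\<lambda>j. exp (theta lam j x t))" and "q = (\<lambda>j. exp (- theta lam j x t))"
  let ?p' = "\<lambda>j. p (Suc N - j)" and ?q' = "\<lambda>j. q (Suc N - j)"
  have u: "u_soliton \<sigma> N lam c s x t = - 2 * soliton_num \<sigma> N lam c s p q / soliton_den \<sigma> N lam c p q"
    by (rule u_soliton_eq_num_den[of "\<lambda>_. 1"]) (auto simp: p_def q_def)
  have u': "u_soliton \<sigma> N lam' c' s x t = - 2 * soliton_num \<sigma> N lam' c' s ?p' ?q' / soliton_den \<sigma> N lam' c' ?p' ?q'"
    by (rule u_soliton_eq_num_den[of "\<lambda>_. 1"]) (auto simp: p_def q_def theta_rev)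
  have idx: "Suc N - Suc i = Suc (N - 1 - i)" if "i < N" for i using that by auto
  have "soliton_den \<sigma> N lam' c' ?p' ?q'
      = fdet N (\<lambda>i j. pq_entry \<sigma> lam c p q (Suc (N - 1 - i)) (Suc (N - 1 - j)))"
    unfolding soliton_den_def pq_entry_rev by (rule fdet_cong) (simp_all only: idx)
  also have "\<dots> = soliton_den \<sigma> N lam c p q"
    unfolding soliton_den_def by (rule fdet_rev[of N "\<lambda>i j. pq_entry \<sigma> lam c p q (Suc i) (Suc j)"])
  finally have soliton_den: "soliton_den \<sigma> N lam' c' ?p' ?q' = soliton_den \<sigma> N lam c p q" .
  \<comment> \<open>The reversal acts on the solitons only and leaves the border index
    \<open>N\<close> in place.\<close>
  define \<pi> where "\<pi> = (\<lambda>i. if i < N then N - 1 - i else i)"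
  have "bij_betw \<pi> {0..<Suc N} {0..<Suc N}"
    by (rule bij_betwI[where g = \<pi>]) (auto simp: \<pi>_def)
  then have \<pi>: "\<pi> permutes {0..<Suc N}"
    by (rule bij_imp_permutes) (auto simp: \<pi>_def)
  have "soliton_num \<sigma> N lam' c' s ?p' ?q' = fdet (Suc N) (\<lambda>i j. pq_bordered \<sigma> N lam c s p q (\<pi> i) (\<pi> j))"
    unfolding soliton_num_def
    by (rule fdet_cong) (auto simp: pq_bordered_def pq_entry_rev c' \<pi>_def Suc_diff_Suc)
  also have "\<dots> = soliton_num \<sigma> N lam c s p q"
    unfolding soliton_num_def by (rule fdet_permute_same[OF \<pi>])
  finally show ?thesis unfolding u u' soliton_den by simp
qed

lemma det_C_low_rev:
  assumes "m \<le> N"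
  shows "det (C_low \<sigma> lam' c' m) = det (C_up \<sigma> N lam c (Suc N - m))"
proof -
  define f where "f = (\<lambda>i j. cauchy_entry \<sigma> lam c (Suc N - m + i) (Suc N - m + j))"
  have "det (C_low \<sigma> lam' c' m) = fdet m (\<lambda>i j. f (m - 1 - i) (m - 1 - j))"
    unfolding C_low_def cauchy_entry_rev fdet_def[symmetric]
    by (rule fdet_cong) (use assms in \<open>auto simp: f_def\<close>)
  also have "\<dots> = fdet m f" by (rule fdet_rev)
  also have "\<dots> = det (C_up \<sigma> N lam c (Suc N - m))"
    using assms by (simp add: C_up_def fdet_def f_def)
  finally show ?thesis .
qed

text \<open>Reversal of rows and columns moves the row of norming constants from the last to the
  first position.\<close>

lemma det_Chat_low_rev:
  assumes "k \<in> {1..N}"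
  shows "det (Chat_low \<sigma> lam' c' s (Suc N - k)) = det (Chat_up \<sigma> N lam c s k)"
proof -
  let ?m = "Suc N - k"
  define f where "f = (\<lambda>i j. if i = 0 then c (k + j) s else cauchy_entry \<sigma> lam c (k + i) (k + j))"
  have "det (Chat_low \<sigma> lam' c' s ?m) = fdet ?m (\<lambda>i j. f (?m - 1 - i) (?m - 1 - j))"
    unfolding Chat_low_def cauchy_entry_rev c' fdet_def[symmetric]
    by (rule fdet_cong) (use assms in \<open>auto simp: f_def\<close>)
  also have "\<dots> = fdet ?m f" by (rule fdet_rev)
  also have "\<dots> = det (Chat_up \<sigma> N lam c s k)"
    by (simp add: Chat_up_def fdet_def f_def)
  finally show ?thesis .
qed

lemma u_minus_rev:
  assumes "k \<in> {1..N}"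
  shows "u_minus \<sigma> N lam' c' s (Suc N - k) x t = u_plus \<sigma> N lam c s k x t"
proof -
  have kk: "Suc N - (Suc N - k) = k" "Suc N - k - 1 = Suc N - (k + 1)" "Suc N - k \<le> N"
      "Suc N - (k + 1) \<le> N" "Suc N - (Suc N - (k + 1)) = k + 1"
    using assms by auto
  have bij: "bij_betw (\<lambda>j. Suc N - j) {Suc N - k + 1..N} {1..<k}"
    by (rule bij_betwI[where g = "\<lambda>j. Suc N - j"]) (use assms in auto)
  have theta: "theta_minus N lam' (Suc N - k) x t = theta_plus lam k x t"
    unfolding theta_minus_def theta_plus_def theta_rev zpar_rev kk
    using sum.reindex_bij_betw[OF bij, of "\<lambda>j. ln ((zpar lam j - zpar lam k) / (cnj (zpar lam j) - zpar lam k))"]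
    by simp
  have ratio: "zratio lam' (Suc N - k) = zratio lam k"
    by (simp only: zratio_def zpar_rev kk)
  have C: "det (C_low \<sigma> lam' c' (Suc N - k)) = det (C_up \<sigma> N lam c k)"
    "det (C_low \<sigma> lam' c' (Suc N - k - 1)) = det (C_up \<sigma> N lam c (k + 1))"
    using det_C_low_rev[OF kk(3)] det_C_low_rev[OF kk(4)] by (simp_all only: kk)
  have delta: "delta_minus \<sigma> lam' c' (Suc N - k) = delta_plus \<sigma> N lam c k"
    unfolding delta_minus_def delta_plus_def ratio C ..
  have chat: "chat_minus \<sigma> N lam' c' s (Suc N - k) = chat_plus \<sigma> N lam c s k"
    unfolding chat_minus_def chat_plus_def C zpar_rev det_Chat_low_rev[OF assms]
    using prod.reindex_bij_betw[OF bij, of "\<lambda>j. (zpar lam j)\<^sup>2 / of_real ((cmod (zpar lam j))\<^sup>2)"]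
    by simp
  have lamk: "lam' (Suc N - k) = lam k" by (simp only: lam' kk)
  show ?thesis
    unfolding u_minus_def u_plus_def theta ratio delta chat lamk ..
qed

lemma sum_u_minus_rev:
  "(\<Sum>k=1..N. u_minus \<sigma> N lam' c' s k x t) = (\<Sum>k=1..N. u_plus \<sigma> N lam c s k x t)"
proof -
  have bij: "bij_betw (\<lambda>k. Suc N - k) {1..N} {1..N}"
    by (rule bij_betwI[where g = "\<lambda>k. Suc N - k"]) auto
  have "(\<Sum>k=1..N. u_minus \<sigma> N lam' c' s k x t) = (\<Sum>k=1..N. u_minus \<sigma> N lam' c' s (Suc N - k) x t)"
    by (rule sum.reindex_bij_betw[OF bij, symmetric])
  also have "\<dots> = (\<Sum>k=1..N. u_plus \<sigma> N lam c s k x t)"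
    by (rule sum.cong) (auto simp: u_minus_rev)
  finally show ?thesis .
qed

lemma vel_rev: "vel lam' i = vel lam (Suc N - i)"
  by (simp add: vel_def zpar_rev)

end

section \<open>The decay rate and the two time directions\<close>

lemma decay_rate_le:
  assumes "i \<in> {1..N}" "j \<in> {1..N}" "i \<noteq> j"
  shows "decay_rate N lam \<le> \<bar>Im (zpar lam i)\<bar> * \<bar>vel lam i - vel lam j\<bar>"
proof -
  let ?A = "{\<bar>Im (zpar lam i)\<bar> | i. i \<in> {1..N}}"
  let ?B = "{\<bar>vel lam i - vel lam j\<bar> | i j. i \<in> {1..N} \<and> j \<in> {1..N} \<and> i \<noteq> j}"
  have A: "finite ?A" by simp
  have "?B \<subseteq> (\<lambda>(i, j). \<bar>vel lam i - vel lam j\<bar>) ` ({1..N} \<times> {1..N})" by auto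
  then have B: "finite ?B" by (rule finite_subset) simp
  have "Min ?A \<le> \<bar>Im (zpar lam i)\<bar>" by (rule Min_le[OF A]) (use assms in auto)
  moreover have "Min ?B \<le> \<bar>vel lam i - vel lam j\<bar>" by (rule Min_le[OF B]) (use assms in auto)
  \<comment> \<open>The minimum is attained, since \<open>i \<noteq> j\<close> provides an element;
    its nonnegativity is what monotonicity of the product requires.\<close>
  moreover have "Min ?B \<in> ?B" by (rule Min_in[OF B]) (use assms in auto)
  then have "Min ?B \<ge> 0" by auto
  ultimately show ?thesis unfolding decay_rate_def by (intro mult_mono) auto
qed

lemma decay_rate_pos:
  assumes "N \<ge> 2"
    and "\<And>i. i \<in> {1..N} \<Longrightarrow> Im (zpar lam i) < 0" and "inj_on (vel lam) {1..N}"
  shows "decay_rate N lam > 0"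
proof -
  let ?A = "{\<bar>Im (zpar lam i)\<bar> | i. i \<in> {1..N}}"
  let ?B = "{\<bar>vel lam i - vel lam j\<bar> | i j. i \<in> {1..N} \<and> j \<in> {1..N} \<and> i \<noteq> j}"
  have A: "finite ?A" by simp
  have "?B \<subseteq> (\<lambda>(i, j). \<bar>vel lam i - vel lam j\<bar>) ` ({1..N} \<times> {1..N})" by auto
  then have B: "finite ?B" by (rule finite_subset) simp
  have "1 \<in> {1..N}" "2 \<in> {1..N}" using assms(1) by auto
  then have "\<bar>Im (zpar lam 1)\<bar> \<in> ?A" "\<bar>vel lam 1 - vel lam 2\<bar> \<in> ?B" by force+
  then have "Min ?A \<in> ?A" "Min ?B \<in> ?B" by (intro Min_in A B; blast)+
  then have "Min ?A > 0" "Min ?B > 0" using assms(2,3) by (force dest: inj_onD)+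
  then show ?thesis unfolding decay_rate_def by simp
qed

text \<open>The error term is read as a bound uniform in \<open>x\<close> for all large times.
  Nonvanishing of the Cauchy determinants is a hypothesis only for \<open>\<sigma> = - 1\<close>,
  separately for each time direction; for \<open>\<sigma> = 1\<close> it follows from
  \<open>det_C_low_nz\<close>.\<close>

theorem proposition2:
  fixes \<sigma> :: real and N :: nat and lam :: "nat \<Rightarrow> complex"
    and c :: "nat \<Rightarrow> nat \<Rightarrow> complex" and s :: nat
  assumes "\<sigma> = 1 \<or> \<sigma> = - 1"
    and "N \<ge> 1"
    and "s \<in> {1, 2}"
    and "\<And>i. i \<in> {1..N} \<Longrightarrow> Re (lam i) \<noteq> 0 \<and> Im (lam i) \<noteq> 0"
    and "\<And>i. i \<in> {1..N} \<Longrightarrow> Im (zpar lam i) < 0"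
    and "strict_mono_on {1..N} (vel lam)"
    and "\<And>i. i \<in> {1..N} \<Longrightarrow> c i 1 \<noteq> 0 \<or> c i 2 \<noteq> 0"
  shows
    "((\<sigma> = - 1 \<longrightarrow> (\<forall>k\<in>{1..N}. det (C_low \<sigma> lam c k) \<noteq> 0)) \<longrightarrow>
       (\<exists>K. \<forall>\<^sub>F t in at_bot. \<forall>x.
          cmod (u_soliton \<sigma> N lam c s x t - (\<Sum>k=1..N. u_minus \<sigma> N lam c s k x t))
            \<le> K * exp (- decay_rate N lam * \<bar>t\<bar>)))
   \<and> ((\<sigma> = - 1 \<longrightarrow> (\<forall>k\<in>{1..N}. det (C_up \<sigma> N lam c k) \<noteq> 0)) \<longrightarrow>
       (\<exists>K. \<forall>\<^sub>F t in at_top. \<forall>x.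
          cmod (u_soliton \<sigma> N lam c s x t - (\<Sum>k=1..N. u_plus \<sigma> N lam c s k x t))
            \<le> K * exp (- decay_rate N lam * \<bar>t\<bar>)))"
proof (intro conjI impI)
  let ?d = "decay_rate N lam"
  have vel_less: "vel lam i < vel lam j" if "i \<in> {1..N}" "j \<in> {1..N}" "i < j" for i j
    by (rule strict_mono_onD[OF assms(6) that])
  have vel_inj: "inj_on (vel lam) {1..N}" by (rule strict_mono_on_imp_inj_on[OF assms(6)])
  have "inj_on (zpar lam) {1..N}"
    by (rule inj_onI, rule inj_onD[OF vel_inj]) (auto simp: vel_def)
  then interpret solitons \<sigma> N lam c
    using assms(4,5) by unfold_locales auto
  have d_pos: "?d > 0" if "N \<noteq> 1"
    by (rule decay_rate_pos[OF _ assms(5) vel_inj]) (use assms(2) that in auto)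
  {
    assume "\<sigma> = - 1 \<longrightarrow> (\<forall>k\<in>{1..N}. det (C_low \<sigma> lam c k) \<noteq> 0)"
    then have dets: "det (C_low \<sigma> lam c k) \<noteq> 0" if "k \<in> {1..N}" for k
      using det_C_low_nz[of k] assms(1,7) that by auto
    obtain K T where "T > 0" and KT: "\<forall>x t. T \<le> \<bar>t\<bar> \<longrightarrow>
        (\<forall>i\<in>{1..N}. \<forall>j\<in>{1..N}. i < j \<longrightarrow> vel lam j * t < vel lam i * t) \<longrightarrow>
        cmod (u_soliton \<sigma> N lam c s x t - (\<Sum>k=1..N. u_minus \<sigma> N lam c s k x t))
          \<le> K * exp (- ?d * \<bar>t\<bar>)"
      using asymptotics[OF assms(2) dets decay_rate_le d_pos, where s = s] by blast
    have "\<forall>t\<le>- T. \<forall>x. cmod (u_soliton \<sigma> N lam c s x t - (\<Sum>k=1..N. u_minus \<sigma> N lam c s k x t))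
        \<le> K * exp (- ?d * \<bar>t\<bar>)"
    proof (intro allI impI)
      fix t x :: real
      assume "t \<le> - T"
      then show "cmod (u_soliton \<sigma> N lam c s x t - (\<Sum>k=1..N. u_minus \<sigma> N lam c s k x t))
          \<le> K * exp (- ?d * \<bar>t\<bar>)"
        using \<open>T > 0\<close> vel_less
        by (intro KT[rule_format]) (auto intro: mult_strict_right_mono_neg)
    qed
    then show "\<exists>K. \<forall>\<^sub>F t in at_bot. \<forall>x.
        cmod (u_soliton \<sigma> N lam c s x t - (\<Sum>k=1..N. u_minus \<sigma> N lam c s k x t))
          \<le> K * exp (- ?d * \<bar>t\<bar>)"
      unfolding eventually_at_bot_linorder by blast
  }
  {
    assume up: "\<sigma> = - 1 \<longrightarrow> (\<forall>k\<in>{1..N}. det (C_up \<sigma> N lam c k) \<noteq> 0)"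
    \<comment> \<open>For \<open>t > 0\<close> the fastest soliton is rightmost; in the reversed
      numbering the positions decrease with the index, as \<open>asymptotics\<close>
      demands.\<close>
    define lam' c' where "lam' = (\<lambda>i. lam (Suc N - i))" and "c' = (\<lambda>i. c (Suc N - i))"
    interpret rev: reversal N lam lam' c c'
      by unfold_locales (auto simp: lam'_def c'_def)
    have mem: "Suc N - i \<in> {1..N}" if "i \<in> {1..N}" for i using that by auto
    have "inj_on (zpar lam') {1..N}"
    proof (rule inj_onI)
      fix i j assume ij: "i \<in> {1..N}" "j \<in> {1..N}" "zpar lam' i = zpar lam' j"
      then have "Suc N - i = Suc N - j"
        using inj_onD[OF z_inj _ mem mem] by (simp add: rev.zpar_rev)
      then show "i = j" using ij by auto
    qed
    moreover have "Re (lam' i) \<noteq> 0 \<and> Im (lam' i) \<noteq> 0" "Im (zpar lam' i) < 0" if "i \<in> {1..N}" for i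
      using assms(4,5)[OF mem[OF that]] unfolding rev.zpar_rev rev.lam' by blast+
    ultimately interpret r: solitons \<sigma> N lam' c'
      by unfold_locales
    \<comment> \<open>The lower determinants of the reversed family are the upper ones of the
      original; for \<open>\<sigma> = 1\<close> the nonvanishing lemma applies to the reversed
      family directly.\<close>
    have dets: "det (C_low \<sigma> lam' c' k) \<noteq> 0" if k: "k \<in> {1..N}" for k
    proof (cases "\<sigma> = 1")
      case True
      then show ?thesis
        by (rule r.det_C_low_nz) (use k assms(7) mem in \<open>auto simp: c'_def\<close>)
    next
      case False
      then show ?thesis using rev.det_C_low_rev[of k] up assms(1) mem[OF k] k by auto
    qed
    have rate: "?d \<le> \<bar>Im (zpar lam' i)\<bar> * \<bar>vel lam' i - vel lam' j\<bar>"
      if "i \<in> {1..N}" "j \<in> {1..N}" "i \<noteq> j" for i j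
      unfolding rev.zpar_rev rev.vel_rev by (rule decay_rate_le) (use that in auto)
    obtain K T where "T > 0" and KT: "\<forall>x t. T \<le> \<bar>t\<bar> \<longrightarrow>
        (\<forall>i\<in>{1..N}. \<forall>j\<in>{1..N}. i < j \<longrightarrow> vel lam' j * t < vel lam' i * t) \<longrightarrow>
        cmod (u_soliton \<sigma> N lam' c' s x t - (\<Sum>k=1..N. u_minus \<sigma> N lam' c' s k x t))
          \<le> K * exp (- ?d * \<bar>t\<bar>)"
      using r.asymptotics[OF assms(2) dets rate d_pos, where s = s] by blast
    have "\<forall>t\<ge>T. \<forall>x. cmod (u_soliton \<sigma> N lam c s x t - (\<Sum>k=1..N. u_plus \<sigma> N lam c s k x t))
        \<le> K * exp (- ?d * \<bar>t\<bar>)"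
    proof (intro allI impI)
      fix t x :: real
      assume t: "T \<le> t"
      have "vel lam' j * t < vel lam' i * t" if "i \<in> {1..N}" "j \<in> {1..N}" "i < j" for i j
        using vel_less[of "Suc N - j" "Suc N - i"] that t \<open>T > 0\<close>
        by (auto simp: rev.vel_rev intro!: mult_strict_right_mono)
      then show "cmod (u_soliton \<sigma> N lam c s x t - (\<Sum>k=1..N. u_plus \<sigma> N lam c s k x t))
          \<le> K * exp (- ?d * \<bar>t\<bar>)"
        using KT[rule_format, of t x, unfolded rev.u_soliton_rev rev.sum_u_minus_rev] t \<open>T > 0\<close>
        by simp
    qed
    then show "\<exists>K. \<forall>\<^sub>F t in at_top. \<forall>x.
        cmod (u_soliton \<sigma> N lam c s x t - (\<Sum>k=1..N. u_plus \<sigma> N lam c s k x t))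
          \<le> K * exp (- ?d * \<bar>t\<bar>)"
      unfolding eventually_at_top_linorder by blast
  }
qed

end
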